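(* For all positive integers $a,b,n$, $$\mathrm{ehr}_{\mathfrak X_n(a,b)}(t)=\frac1{2^n}\sum_{i=0}^{\lfloor n/2\rfloor}\sum_{j=2i}^{n}(-1)^{i+1}\binom{n}{n-j,\ j-2i,\ i,\ i}\,i!\,(2j-4i-3)!!\,(bt)^{j-i}\bigl((2bn-b+2a-2)t+2\bigr)^{n-j},$$ where $(2j-4i-3)!!:=-\prod_{k=1}^{j-2i}(2k-3)$ (so that $(-1)!!=1$ and $(-3)!!=-1$) and $\binom{n}{n-j,\,j-2i,\,i,\,i}=\frac{n!}{(n-j)!\,(j-2i)!\,i!\,i!}$. Equivalently, for all positive integers $a,b$, with $\beta:=\frac{a-1}{b}-\frac12+\frac1{bt}$ and $\mathrm{ehr}_{\mathfrak X_0(a,b)}(t):=1$, the following identity of formal power series in $z$ holds: $$\sum_{n\ge0}\mathrm{ehr}_{\mathfrak X_n(a,b)}(t)\,\frac{z^n}{n!}=\frac1{\sqrt{1-T(btz)}}\,\exp\!\left[\beta\,T(btz)-\frac{T(btz)^2}{4bt}\right].$$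
   Context: For $\mathbf b=(b_1,\dots,b_n)\in\mathbb Z_{>0}^n$, a $\mathbf b$-parking function is a list $(\beta_1,\dots,\beta_n)$ of positive integers whose nondecreasing rearrangement $\beta_1'\le\cdots\le\beta_n'$ satisfies $\beta_i'\le b_1+\cdots+b_i$ for all $i$. The polytope $\mathfrak X_n(\mathbf b)\subset\mathbb R^n$ is the convex hull of all $\mathbf b$-parking functions of length $n$, and for positive integers $a,b$, $\mathfrak X_n(a,b):=\mathfrak X_n(a,b,\dots,b)$ (parameter vector of length $n$ with first entry $a$ and all other entries $b$; for $n=1$ it is $\mathfrak X_1(a)$). For a lattice polytope $P\subset\mathbb R^n$, $\mathrm{ehr}_P(t)$ is the polynomial in $t$ that equals $\#(tP\cap\mathbb Z^n)$ at every positive integer $t$. The tree function is the formal power series $T(z)=\sum_{m\ge1}m^{m-1}\frac{z^m}{m!}$, satisfying $T(z)=z\,e^{T(z)}$. *)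

theory Defs
  imports
    "HOL-Analysis.Analysis"
    "HOL-Analysis.Finite_Function_Topology"
    "HOL-Computational_Algebra.Computational_Algebra"
begin

text \<open>
  The dimension \<open>n\<close> varies inside the theorem, so \<open>\<real>\<^sup>n\<close> is realised as the subspace of the real
  vector space \<^typ>\<open>nat \<Rightarrow>\<^sub>0 real\<close> of those vectors whose coordinates outside \<open>{..<n}\<close> vanish.
  Coordinates are indexed from 0.
\<close>

definition integer_lattice :: "nat \<Rightarrow> (nat \<Rightarrow>\<^sub>0 real) set" where
  "integer_lattice n =
     {x. Poly_Mapping.keys x \<subseteq> {..<n} \<and> (\<forall>i<n. Poly_Mapping.lookup x i \<in> \<int>)}"

text \<open>
  For a lattice polytope \<open>P\<close> the polynomial exists (Ehrhart) and is unique; for other \<open>P\<close> the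
  value is unspecified.
\<close>

definition ehrhart_poly :: "nat \<Rightarrow> (nat \<Rightarrow>\<^sub>0 real) set \<Rightarrow> real poly" where
  "ehrhart_poly n P =
     (THE p. \<forall>k::nat. k > 0 \<longrightarrow>
        poly p (real k) = real (card ((\<lambda>x. real k *\<^sub>R x) ` P \<inter> integer_lattice n)))"

definition parking_functions :: "nat list \<Rightarrow> nat list set" where
  "parking_functions b =
     {\<beta>. length \<beta> = length b \<and> (\<forall>x\<in>set \<beta>. x > 0) \<and>
        (\<forall>i<length b. sort \<beta> ! i \<le> sum_list (take (Suc i) b))}"

text \<open>\<^const>\<open>Poly_Mapping.nth\<close> turns a list into the vector with these coordinates, padded by 0.\<close>

definition parking_polytope :: "nat list \<Rightarrow> (nat \<Rightarrow>\<^sub>0 real) set" where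
  "parking_polytope b =
     convex hull ((\<lambda>\<beta>. Poly_Mapping.nth (map real \<beta>)) ` parking_functions b)"

fun param_vector :: "nat \<Rightarrow> nat \<Rightarrow> nat \<Rightarrow> nat list" where
  "param_vector 0 a b = []"
| "param_vector (Suc n) a b = a # replicate n b"

definition ehr_parking :: "nat \<Rightarrow> nat \<Rightarrow> nat \<Rightarrow> real poly" where
  "ehr_parking n a b =
     (if n = 0 then 1 else ehrhart_poly n (parking_polytope (param_vector n a b)))"

text \<open>
  \<open>(2m - 3)!!\<close> as a function of \<open>m\<close>, extended to negative arguments: \<open>(-1)!! = 1\<close> at \<open>m = 1\<close>
  and \<open>(-3)!! = -1\<close> at \<open>m = 0\<close>.
\<close>

definition dfact_2m_minus_3 :: "nat \<Rightarrow> real" where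
  "dfact_2m_minus_3 m = - (\<Prod>k=1..m. 2 * real k - 3)"

definition tree_fps :: "real fps" where
  "tree_fps = Abs_fps (\<lambda>m. if m = 0 then 0 else real m ^ (m - 1) / fact m)"

end

theory Submission
  imports Defs
begin

text \<open>
  Subtract \<open>1\<close> from every coordinate. The \<open>k\<close>-th dilate of the polytope becomes the polymatroid of
  all \<open>y \<ge> 0\<close> with \<open>y(S) \<le> (c - 1)|S| + m e\<^sub>n(|S|)\<close> for every set \<open>S\<close> of coordinates. Here \<open>y(S)\<close>
  is the sum of \<open>y\<close> over \<open>S\<close>, \<open>m = kb\<close>, \<open>c = k(a - 1) + 1\<close>, and \<open>e\<^sub>n(s)\<close> is the number of edges of the
  complete graph \<open>K\<^sub>n\<close> that meet a given set of \<open>s\<close> vertices. Parking functions satisfy these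
  inequalities because the \<open>s\<close> largest entries of a permutation of \<open>0, \<dots>, n - 1\<close> have sum \<open>e\<^sub>n(s)\<close>;
  conversely every point of the polymatroid is a convex combination of greedy vertices
  (\<open>feasible_in_hull\<close>). It remains to count the integer points \<open>N\<^sub>n(c)\<close> of the polymatroid.

  Fix \<open>m\<close>. Let \<open>I\<^sub>n\<close> be the number of integer \<open>y \<ge> 0\<close> with \<open>y(S) < m e\<^sub>n(|S|)\<close> for all nonempty \<open>S\<close>,
  and let \<open>Z\<^sub>n(l)\<close> be the number of integer \<open>y\<close> with
  \<open>m binom(|S|, 2) \<le> y(S) \<le> l|S| + m e\<^sub>n(|S|)\<close>. Three exact identities hold:

  \<^item> \<open>\<Sum>\<^sub>k binom(n, k) I\<^sub>k N\<^sub>n\<^sub>-\<^sub>k(c) = (c + m(n - 1))\<^sup>n\<close> (\<open>polymatroid_interior_convolution\<close>);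
  \<^item> \<open>N\<^sub>n(c) = \<Sum>\<^sub>k binom(n, k) I\<^sub>k Z\<^sub>n\<^sub>-\<^sub>k(c - 1)\<close> (\<open>polymatroid_eq_interior_zonotope\<close>);
  \<^item> \<open>Z\<^sub>n\<^sub>+\<^sub>1(0) = Z\<^sub>n(m)\<close> (\<open>zonotope_count_Suc\<close>).

  In the first two, every point \<open>y\<close> (of a cube, respectively of the polymatroid) determines a set
  \<open>U\<close>, the least maximizer of a supermodular function of the form \<open>\<plusminus>(y(S) - f(|S|))\<close>. That \<open>U\<close> is this
  set is a condition on \<open>y\<close> restricted to \<open>U\<close> together with a condition on \<open>y\<close> restricted to the
  complement, so the points with a given \<open>U\<close> form a product. In the third identity one coordinate
  is determined by the others and is dropped.

  Write \<open>I\<close>, \<open>N(c)\<close>, \<open>Z(l)\<close> for the exponential generating functions and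
  \<open>E(c) = \<Sum>\<^sub>n (c + m(n - 1))\<^sup>n z\<^sup>n / n!\<close>. The identities say \<open>I N(c) = E(c)\<close>, \<open>N(c) = I Z(c - 1)\<close> and
  \<open>P' = Z(m)\<close> for \<open>P = Z(0)\<close>. Hence \<open>I\<^sup>2 P = E(1)\<close> and \<open>I\<^sup>2 P' = E(m + 1)\<close>. By Abel's identity
  \<open>E(c) = exp((c - m) T / m) / (1 - T)\<close> with \<open>T = T(mz)\<close>, so \<open>P' = P e\<^sup>T\<close>. This gives
  \<open>P = exp((T - T\<^sup>2 / 2) / m)\<close>, and then \<open>N(c)\<^sup>2 = E(c)\<^sup>2 P / E(1)\<close> is the square of the claimed
  generating function (\<open>egf_eq_ehrhart_gf\<close>). Lagrange inversion extracts the coefficients and yields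
  the double sum (\<open>ehrhart_gf_eq_egf\<close>). The double sum is a polynomial in \<open>t\<close> that has the right
  values at all positive integers, so it is the Ehrhart polynomial.
\<close>

unbundle no vec_syntax

section \<open>Lagrange inversion for the tree function\<close>

lemma fps_deriv_exp_uminus_compose:
  fixes p :: "real fps"
  assumes "p $ 0 = 0"
  shows "fps_deriv (fps_exp (-1) oo p) = - (fps_exp (-1) oo p) * fps_deriv p"
proof -
  have "fps_const (-1) * fps_exp (-1) = - fps_exp (-1 :: real)"
    by (simp only: fps_const_neg[symmetric] fps_const_1_eq_1 mult_minus1)
  then show ?thesis
    by (simp only: fps_compose_deriv[OF assms] fps_exp_deriv fps_compose_uminus)
qed

text \<open>
  The \<open>M\<close>-th finite difference of an \<open>M\<close>-th power. The sum is \<open>M!\<close> times the coefficient of \<open>X\<^sup>M\<close> in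
  \<open>(e\<^sup>X - 1)\<^sup>M e\<^sup>x\<^sup>X\<close>, and \<open>(e\<^sup>X - 1)\<^sup>M\<close> begins with \<open>X\<^sup>M\<close>.
\<close>

lemma finite_difference_power:
  fixes x :: real
  shows "(\<Sum>j\<le>M. (-1) ^ (M - j) * of_nat (M choose j) * (x + of_nat j) ^ M) = fact M"
proof -
  let ?D = "fps_exp (1::real) - 1"
  \<comment> \<open>The coefficients of \<open>?D ^ M\<close> up to position \<open>M\<close>; they select a single term below.\<close>
  have lead: "(?D ^ M) $ k = (if k < M then 0 else 1)" if "k \<le> M" for k
  proof -
    have "?D = fps_X * fps_shift 1 ?D"
      by (rule fps_ext) (auto simp: fps_X_mult_nth)
    then have "?D ^ M = fps_X ^ M * fps_shift 1 ?D ^ M"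
      by (metis power_mult_distrib)
    then have "(?D ^ M) $ k = (if k < M then 0 else (fps_shift 1 ?D ^ M) $ (k - M))"
      by (metis fps_X_power_mult_nth)
    with that show ?thesis by (auto simp: fps_power_zeroth)
  qed
  have "?D ^ M = (\<Sum>j\<le>M. of_nat (M choose j) * fps_exp 1 ^ j * (- 1) ^ (M - j))"
    using binomial_ring[of "fps_exp (1::real)" "-1" M] by (simp add: field_simps)
  also have "\<dots> * fps_exp x =
      (\<Sum>j\<le>M. fps_const ((-1) ^ (M - j) * of_nat (M choose j)) * fps_exp (x + of_nat j))"
    unfolding sum_distrib_right
  proof (rule sum.cong[OF refl])
    fix j
    have "fps_const ((-1) ^ (M - j) * of_nat (M choose j) :: real)
            = (- 1) ^ (M - j) * of_nat (M choose j)"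
      by (simp flip: fps_const_mult fps_const_power add: fps_of_nat fps_const_neg[symmetric] del: fps_const_mult fps_const_neg)
    then show "of_nat (M choose j) * fps_exp 1 ^ j * (- 1) ^ (M - j) * fps_exp x =
        fps_const ((-1) ^ (M - j) * of_nat (M choose j)) * fps_exp (x + of_nat j)"
      by (simp add: fps_exp_add_mult fps_exp_power_mult algebra_simps)
  qed
  finally have eq: "?D ^ M * fps_exp x = \<dots>" .
  have "(?D ^ M * fps_exp x) $ M = (\<Sum>k\<le>M. (?D ^ M) $ k * fps_exp x $ (M - k))"
    by (simp add: fps_mult_nth atLeast0AtMost)
  also have "\<dots> = (\<Sum>k\<le>M. if k = M then 1 else 0)"
    by (rule sum.cong) (auto simp: lead)
  also have "\<dots> = 1" by simp
  finally have "1 = (\<Sum>j\<le>M. (-1) ^ (M - j) * of_nat (M choose j) * ((x + of_nat j) ^ M / fact M))"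
    unfolding eq by (simp add: fps_sum_nth)
  also have "\<dots> = (\<Sum>j\<le>M. (-1) ^ (M - j) * of_nat (M choose j) * (x + of_nat j) ^ M) / fact M"
    by (simp add: sum_divide_distrib)
  finally show ?thesis by simp
qed

text \<open>
  Lagrange inversion, read backwards so that nothing has to be inverted. After composition with
  \<open>X e\<^sup>-\<^sup>X\<close> the contribution of each coefficient of \<open>K\<close> to the coefficient of \<open>X\<^sup>N\<close> is a finite
  difference as above, so it equals that coefficient of \<open>K\<close>, and the prefix sums of the coefficients of \<open>K\<close>
  remain.
\<close>

lemma lagrange_compose_inverse:
  fixes K :: "real fps"
  shows "Abs_fps (\<lambda>n. (K * fps_exp (of_nat n)) $ n) oo (fps_X * fps_exp (-1)) = K * inverse (1 - fps_X)"
proof (rule fps_ext)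
  fix N
  let ?a = "\<lambda>n k. K $ k * (of_nat n ^ (n - k) / fact (n - k)) * ((- of_nat n) ^ (N - n) / fact (N - n)) :: real"
  have pw: "((fps_X * fps_exp (-1)) ^ n :: real fps) $ N = (- of_nat n) ^ (N - n) / fact (N - n)"
    if "n \<le> N" for n
    using that by (simp add: power_mult_distrib fps_exp_power_mult fps_X_power_mult_nth)
  \<comment> \<open>The contribution of \<open>K $ k\<close>, summed over all \<open>n\<close>, is a finite difference at the point \<open>k\<close>.\<close>
  have col: "(\<Sum>n=k..N. ?a n k) = K $ k" if "k \<le> N" for k
  proof -
    let ?M = "N - k"
    have "(\<Sum>n=k..N. ?a n k) = (\<Sum>j\<le>?M. ?a (k + j) k)"
      by (rule sum.reindex_bij_witness[of _ "\<lambda>j. k + j" "\<lambda>n. n - k"]) (use that in auto)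
    also have "\<dots> = (\<Sum>j\<le>?M. K $ k / fact ?M * ((-1) ^ (?M - j) * of_nat (?M choose j) * (of_nat k + of_nat j) ^ ?M))"
    proof (rule sum.cong[OF refl])
      fix j assume "j \<in> {..?M}"
      then have j: "j \<le> ?M" by simp
      let ?x = "of_nat k + of_nat j :: real"
      have "?x ^ j * ?x ^ (?M - j) = ?x ^ ?M"
        using j by (simp del: diff_diff_left flip: power_add)
      then have pow: "?x ^ j * (- ?x) ^ (?M - j) = (-1) ^ (?M - j) * ?x ^ ?M"
        unfolding power_minus[of ?x] by (simp del: diff_diff_left minus_add_distrib)
      have "?a (k + j) k = K $ k * (?x ^ j * (- ?x) ^ (?M - j)) / (fact j * fact (?M - j))"
        by (simp add: diff_diff_left)
      also note pow
      also have "K $ k * ((-1) ^ (?M - j) * ?x ^ ?M) / (fact j * fact (?M - j)) =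
          K $ k / fact ?M * ((-1) ^ (?M - j) * of_nat (?M choose j) * ?x ^ ?M)"
        using j by (simp add: binomial_fact)
      finally show "?a (k + j) k = \<dots>" .
    qed
    also have "\<dots> = K $ k"
      unfolding sum_distrib_left[symmetric] finite_difference_power by simp
    finally show ?thesis .
  qed
  have "(Abs_fps (\<lambda>n. (K * fps_exp (of_nat n)) $ n) oo (fps_X * fps_exp (-1))) $ N
      = (\<Sum>n=0..N. \<Sum>k=0..n. ?a n k)"
    unfolding fps_compose_nth
    by (rule sum.cong[OF refl]) (simp add: pw fps_mult_nth sum_distrib_right sum_divide_distrib)
  also have "\<dots> = (\<Sum>k=0..N. \<Sum>n=k..N. ?a n k)"
    unfolding sum.Sigma[OF finite_atLeastAtMost ballI[OF finite_atLeastAtMost]]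
    by (rule sum.reindex_bij_witness[of _ "\<lambda>(k, n). (n, k)" "\<lambda>(n, k). (k, n)"]) auto
  also have "\<dots> = (\<Sum>k=0..N. K $ k)" by (rule sum.cong[OF refl], rule col) simp
  also have "\<dots> = (K * inverse (1 - fps_X)) $ N"
    by (simp add: fps_mult_nth fps_inverse_one_minus_fps_X)
  finally show "(Abs_fps (\<lambda>n. (K * fps_exp (of_nat n)) $ n) oo (fps_X * fps_exp (-1))) $ N = (K * inverse (1 - fps_X)) $ N" .
qed

lemma tree_fps_nth_0 [simp]: "tree_fps $ 0 = 0"
  by (simp add: tree_fps_def)

text \<open>
  For the inverse series \<open>V\<close> of \<open>X e\<^sup>-\<^sup>X\<close>, Lagrange inversion with \<open>K = 1\<close> gives
  \<open>\<Sum>\<^sub>n n\<^sup>n X\<^sup>n / n! = 1 / (1 - V)\<close>. Differentiating \<open>V e\<^sup>-\<^sup>V = X\<close> gives \<open>X V' = 1 / (1 - V) - 1\<close>, and the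
  coefficients \<open>n\<^sup>n\<^sup>-\<^sup>1 / n!\<close> of \<open>V\<close> can be read off.
\<close>

lemma tree_fps_eq_fps_inv: "tree_fps = fps_inv (fps_X * fps_exp (-1))"
proof -
  define V :: "real fps" where "V = fps_inv (fps_X * fps_exp (-1))"
  have V0: "V $ 0 = 0" by (simp add: V_def fps_inv_def)
  have SV: "(fps_X * fps_exp (-1)) oo V = fps_X" 
    unfolding V_def by (rule fps_inv_right) auto
  have "Abs_fps (\<lambda>n. (1 * fps_exp (of_nat n)) $ n :: real) oo (fps_X * fps_exp (-1)) oo V = inverse (1 - fps_X) oo V"
    unfolding lagrange_compose_inverse by simp
  then have A: "Abs_fps (\<lambda>n. (fps_exp (of_nat n)) $ n :: real) = inverse (1 - V)"
    by (simp add: fps_compose_assoc[symmetric] V0 SV fps_inverse_compose fps_compose_sub_distrib)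
  let ?E = "fps_exp (-1) oo V"
  have e: "V * ?E = fps_X" using SV by (simp add: fps_compose_mult_distrib V0)
  have "fps_deriv (V * ?E) = 1" by (simp add: e)
  then have "fps_deriv V * (?E - V * ?E) = 1"
    by (simp add: fps_deriv_exp_uminus_compose V0 algebra_simps)
  then have "V * (fps_deriv V * (?E - V * ?E)) = V" by simp
  then have "fps_X * fps_deriv V * (1 - V) = V"
    unfolding e[symmetric] by (simp add: algebra_simps)
  moreover have u: "(1 - V) * inverse (1 - V) = 1" by (rule inverse_mult_eq_1') (simp add: V0)
  ultimately have "fps_X * fps_deriv V = V * inverse (1 - V)"
    by (metis mult.assoc mult_1_right)
  also have "\<dots> = inverse (1 - V) - 1"
  proof -
    have "inverse (1 - V) - V * inverse (1 - V) = 1"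
      using u by (simp add: left_diff_distrib)
    then show ?thesis by (metis add_diff_cancel_left' diff_add_cancel)
  qed
  finally have "fps_X * fps_deriv V = inverse (1 - V) - 1" .
  then have B: "fps_X * fps_deriv V = Abs_fps (\<lambda>n. (fps_exp (of_nat n)) $ n) - 1"
    unfolding A .
  have "V $ n = tree_fps $ n" for n
  proof (cases n)
    case (Suc k)
    have "real (Suc k) * V $ Suc k = real (Suc k) ^ Suc k / fact (Suc k)"
      using arg_cong[OF B, of "\<lambda>f. f $ Suc k"] by (simp del: fact_Suc power_Suc of_nat_Suc)
    then have "V $ Suc k = real (Suc k) ^ k / fact (Suc k)"
      by (simp del: fact_Suc of_nat_Suc add: field_simps)
    with Suc show ?thesis by (simp add: tree_fps_def)
  qed (simp add: V0)
  then show ?thesis unfolding V_def[symmetric] by (intro fps_ext) simp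
qed

lemma tree_fps_functional_equation: "tree_fps * (fps_exp (-1) oo tree_fps) = fps_X"
proof -
  have "(fps_X * fps_exp (-1)) oo tree_fps = (fps_X :: real fps)"
    unfolding tree_fps_eq_fps_inv by (rule fps_inv_right) auto
  then show ?thesis by (simp add: fps_compose_mult_distrib)
qed

text \<open>
  With \<open>K = H (1 - X)\<close> this is the Lagrange inversion formula
  \<open>[z\<^sup>n] H(T(z)) = [u\<^sup>n] H(u) (1 - u) e\<^sup>n\<^sup>u\<close>.
\<close>

lemma lagrange_tree_fps:
  "Abs_fps (\<lambda>n. (K * fps_exp (of_nat n)) $ n) = (K * inverse (1 - fps_X)) oo tree_fps"
proof -
  have "(fps_X * fps_exp (-1)) oo tree_fps = (fps_X :: real fps)"
    unfolding tree_fps_eq_fps_inv by (rule fps_inv_right) auto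
  then show ?thesis
    unfolding lagrange_compose_inverse[symmetric] by (simp add: fps_compose_assoc[symmetric])
qed

lemma tree_fps_deriv: "fps_deriv tree_fps * (1 - tree_fps) = fps_exp 1 oo tree_fps"
proof -
  let ?E = "fps_exp (-1) oo tree_fps"
  have "fps_deriv (tree_fps * ?E) = 1" by (simp add: tree_fps_functional_equation)
  then have "fps_deriv tree_fps * (1 - tree_fps) * ?E = 1"
    by (simp add: fps_deriv_exp_uminus_compose algebra_simps)
  moreover have "?E * (fps_exp 1 oo tree_fps) = 1"
  proof -
    have "fps_exp (-1) * fps_exp 1 = (1 :: real fps)"
      by (simp only: fps_exp_add_mult[symmetric]) simp
    then have "fps_exp (-1) * fps_exp 1 oo tree_fps = 1 oo tree_fps" by simp
    then show ?thesis
      by (simp only: fps_compose_mult_distrib[OF tree_fps_nth_0] fps_compose_1)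
  qed
  moreover have "D = G" if "D * F = 1" "F * G = 1" for D F G :: "real fps"
    using that by (metis mult.assoc mult_1 mult_1_right)
  ultimately show ?thesis by blast
qed

lemma fps_linear_ODE_unique:
  fixes f g a :: "real fps"
  assumes "fps_deriv f = f * a" "fps_deriv g = g * a" "f $ 0 = g $ 0" "g $ 0 \<noteq> 0"
  shows "f = g"
proof -
  have u: "g * inverse g = 1" by (rule inverse_mult_eq_1') fact
  have "fps_deriv (f * inverse g) = f * a * inverse g - f * (g * inverse g) * a * inverse g"
    using assms by (simp add: fps_inverse_deriv power2_eq_square algebra_simps)
  also have "\<dots> = 0" by (simp add: u)
  finally have "f * inverse g = fps_const ((f * inverse g) $ 0)"
    by (simp only: fps_deriv_eq_0_iff)
  also have "\<dots> = 1" using assms by simp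
  finally have "f * (g * inverse g) = g" by (simp add: algebra_simps)
  then show ?thesis by (simp add: u)
qed

text \<open>
  Both sides solve \<open>f' = f (p' + q')\<close> with constant term \<open>1\<close>.
\<close>

lemma fps_exp_compose_add:
  fixes p q :: "real fps"
  assumes "p $ 0 = 0" "q $ 0 = 0"
  shows "fps_exp 1 oo (p + q) = (fps_exp 1 oo p) * (fps_exp 1 oo q)"
proof (rule fps_linear_ODE_unique[where a = "fps_deriv p + fps_deriv q"])
  show "fps_deriv (fps_exp 1 oo (p + q)) = (fps_exp 1 oo (p + q)) * (fps_deriv p + fps_deriv q)"
    using assms by (simp add: fps_compose_deriv)
  show "fps_deriv ((fps_exp 1 oo p) * (fps_exp 1 oo q)) =
      (fps_exp 1 oo p) * (fps_exp 1 oo q) * (fps_deriv p + fps_deriv q)"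
    using assms by (simp add: fps_compose_deriv distrib_left distrib_right mult_ac)
  show "(fps_exp 1 oo (p + q)) $ 0 = ((fps_exp 1 oo p) * (fps_exp 1 oo q)) $ 0"
    by (simp only: fps_mult_nth_0 fps_compose_nth_0 fps_exp_nth) simp
  show "((fps_exp 1 oo p) * (fps_exp 1 oo q)) $ 0 \<noteq> 0"
    by (simp only: fps_mult_nth_0 fps_compose_nth_0 fps_exp_nth) simp
qed

section \<open>Exponential generating functions\<close>

definition egf :: "(nat \<Rightarrow> real) \<Rightarrow> real fps" where
  "egf f = Abs_fps (\<lambda>n. f n / fact n)"

lemma egf_nth [simp]: "egf f $ n = f n / fact n"
  by (simp add: egf_def)

lemma egf_mult:
  "egf f * egf g = egf (\<lambda>n. \<Sum>k\<le>n. of_nat (n choose k) * f k * g (n - k))"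
proof (rule fps_ext)
  fix n
  have "(egf f * egf g) $ n = (\<Sum>k\<le>n. (of_nat (n choose k) * f k * g (n - k)) / fact n)"
    unfolding fps_mult_nth atLeast0AtMost
    by (rule sum.cong[OF refl]) (simp add: binomial_fact)
  then show "(egf f * egf g) $ n = egf (\<lambda>n. \<Sum>k\<le>n. of_nat (n choose k) * f k * g (n - k)) $ n"
    by (simp add: sum_divide_distrib)
qed

lemma fps_deriv_egf: "fps_deriv (egf f) = egf (\<lambda>n. f (Suc n))"
  by (rule fps_ext) (simp del: of_nat_Suc)

definition scaled_tree_fps :: "real \<Rightarrow> real fps" where
  "scaled_tree_fps m = tree_fps oo (fps_const m * fps_X)"

lemma scaled_tree_fps_nth_0 [simp]: "scaled_tree_fps m $ 0 = 0"
  by (simp add: scaled_tree_fps_def)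

lemma compose_scaled_tree_fps:
  "F oo scaled_tree_fps m = Abs_fps (\<lambda>n. m ^ n * (F oo tree_fps) $ n)"
proof -
  have "F oo scaled_tree_fps m = (F oo tree_fps) oo (fps_const m * fps_X)"
    unfolding scaled_tree_fps_def by (rule fps_compose_assoc) simp_all
  then show ?thesis by (simp only: fps_compose_linear)
qed

text \<open>
  Abel's identity: Lagrange inversion for \<open>K = e\<^sup>y\<^sup>u\<^sup>/\<^sup>m\<close>, for which \<open>K e\<^sup>n\<^sup>u\<close> is again an exponential.
\<close>

lemma abel_egf:
  assumes "m \<noteq> 0"
  shows "egf (\<lambda>n. (y + m * real n) ^ n) = (fps_exp (y / m) * inverse (1 - fps_X)) oo scaled_tree_fps m"
proof (rule fps_ext)
  fix n
  have "m ^ n * (y / m + real n) ^ n = (y + m * real n) ^ n"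
    using assms by (simp add: power_mult_distrib[symmetric] distrib_left)
  then show "egf (\<lambda>n. (y + m * real n) ^ n) $ n = ((fps_exp (y / m) * inverse (1 - fps_X)) oo scaled_tree_fps m) $ n"
    by (simp add: compose_scaled_tree_fps lagrange_tree_fps[symmetric] flip: fps_exp_add_mult)
qed

lemma scaled_tree_fps_deriv:
  "fps_deriv (scaled_tree_fps m) * (1 - scaled_tree_fps m) = fps_const m * (fps_exp 1 oo scaled_tree_fps m)"
proof -
  let ?L = "fps_const m * fps_X"
  have "(fps_deriv tree_fps * (1 - tree_fps)) oo ?L = (fps_exp 1 oo tree_fps) oo ?L"
    by (simp only: tree_fps_deriv)
  then have "(fps_deriv tree_fps oo ?L) * (1 - scaled_tree_fps m) = fps_exp 1 oo scaled_tree_fps m"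
    unfolding scaled_tree_fps_def
    by (simp add: fps_compose_mult_distrib fps_compose_sub_distrib fps_compose_assoc del: fps_exp_compose_linear)
  moreover have "fps_deriv (scaled_tree_fps m) = fps_const m * (fps_deriv tree_fps oo ?L)"
    unfolding scaled_tree_fps_def by (subst fps_compose_deriv) simp_all
  ultimately show ?thesis by (simp add: mult.assoc)
qed

text \<open>
  Up to the factors \<open>1 - X\<close> and their roots, every outer series below is of this form. The
  family is closed under multiplication, which reduces identities between such series to identities
  between their two parameters.
\<close>

definition quadratic_exp :: "real \<Rightarrow> real \<Rightarrow> real fps" where
  "quadratic_exp \<alpha> \<gamma> = fps_exp 1 oo (fps_const \<alpha> * fps_X + fps_const \<gamma> * fps_X ^ 2)"

lemma quadratic_exp_mult:
  "quadratic_exp \<alpha> \<gamma> * quadratic_exp \<alpha>' \<gamma>' = quadratic_exp (\<alpha> + \<alpha>') (\<gamma> + \<gamma>')"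
proof -
  have "fps_const (\<alpha> + \<alpha>') * fps_X + fps_const (\<gamma> + \<gamma>') * fps_X ^ 2 =
      (fps_const \<alpha> * fps_X + fps_const \<gamma> * fps_X ^ 2) + (fps_const \<alpha>' * fps_X + fps_const \<gamma>' * fps_X ^ 2)"
    by (simp add: algebra_simps flip: fps_const_add)
  then show ?thesis
    unfolding quadratic_exp_def by (simp only:) (subst fps_exp_compose_add, simp_all)
qed

lemma fps_exp_eq_quadratic_exp: "fps_exp \<alpha> = quadratic_exp \<alpha> 0"
  by (simp add: quadratic_exp_def)

lemma quadratic_exp_nth_0 [simp]: "quadratic_exp \<alpha> \<gamma> $ 0 = 1"
  by (simp add: quadratic_exp_def)

lemma quadratic_exp_0_nth:
  "quadratic_exp 0 \<gamma> $ p = (if even p then \<gamma> ^ (p div 2) / fact (p div 2) else 0)"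
proof -
  have "quadratic_exp 0 \<gamma> $ p = (\<Sum>i=0..p. if p = 2 * i then \<gamma> ^ i / fact i else 0)"
    unfolding quadratic_exp_def fps_compose_nth
    by (rule sum.cong[OF refl]) (simp add: power_mult_distrib power_mult[symmetric])
  also have "\<dots> = (if even p then \<gamma> ^ (p div 2) / fact (p div 2) else 0)"
    by (cases "even p") (auto elim!: evenE intro!: sum.neutral)
  finally show ?thesis .
qed

lemma quadratic_exp_0_mult_nth:
  "(quadratic_exp 0 \<gamma> * B) $ n = (\<Sum>i=0..n div 2. \<gamma> ^ i / fact i * B $ (n - 2 * i))"
proof -
  have "(quadratic_exp 0 \<gamma> * B) $ n =
      (\<Sum>p=0..n. \<Sum>i=0..n div 2. if p = 2 * i then \<gamma> ^ i / fact i * B $ (n - 2 * i) else 0)"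
    unfolding fps_mult_nth
    by (rule sum.cong[OF refl], subst quadratic_exp_0_nth) (auto elim!: evenE intro!: sum.neutral)
  also have "\<dots> = (\<Sum>i=0..n div 2. \<gamma> ^ i / fact i * B $ (n - 2 * i))"
    by (subst sum.swap) (rule sum.cong[OF refl], auto)
  finally show ?thesis .
qed

text \<open>
  The binomial series of exponent \<open>1/2\<close>; this is where the double factorials come from.
\<close>

lemma sqrt_one_minus_fps_X: 
  "fps_radical root 2 (1 - fps_X) = Abs_fps (\<lambda>l. - dfact_2m_minus_3 l / (2 ^ l * fact l))"
proof -
  define S :: "real fps" where "S = fps_binomial (1/2) oo (- fps_X)"
  have S2: "S ^ 2 = 1 - fps_X"
  proof -
    have "S ^ 2 = (fps_binomial (1/2) ^ 2) oo (- fps_X)"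
      unfolding S_def by (rule fps_compose_power) simp
    also have "\<dots> = (1 + fps_X) oo (- fps_X)"
      by (simp add: fps_binomial_power fps_binomial_1)
    finally show ?thesis by (simp add: fps_compose_add_distrib)
  qed
  have "S = fps_radical root (Suc 1) (1 - fps_X)"
    by (rule iffD1[OF radical_unique]) (use S2 in \<open>simp_all add: S_def numeral_2_eq_2\<close>)
  then have "fps_radical root 2 (1 - fps_X) = S" by (simp add: numeral_2_eq_2)
  also have "\<dots> = Abs_fps (\<lambda>l. - dfact_2m_minus_3 l / (2 ^ l * fact l))"
  proof (rule fps_ext)
    fix l
    have "(-1) ^ l * ((1/2 :: real) gchoose l) = - dfact_2m_minus_3 l / (2 ^ l * fact l)"
    proof (induction l)
      case 0
      show ?case by (simp add: dfact_2m_minus_3_def)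
    next
      case (Suc l)
      have g: "(1/2 :: real) gchoose Suc l = (1/2 gchoose l) * (1/2 - l) / (l + 1)"
        using gbinomial_mult_1[of "1/2 :: real" l] by (simp add: field_simps)
      have "(-1) ^ Suc l * ((1/2 :: real) gchoose Suc l) = 
          ((-1) ^ l * (1/2 gchoose l)) * ((2 * real l - 1) / (2 * (l + 1)))"
        by (subst g) (simp add: field_simps)
      also have "\<dots> = - dfact_2m_minus_3 (Suc l) / (2 ^ Suc l * fact (Suc l))"
        unfolding Suc by (simp add: dfact_2m_minus_3_def prod.nat_ivl_Suc' field_simps)
      finally show ?case .
    qed
    then show "S $ l = Abs_fps (\<lambda>l. - dfact_2m_minus_3 l / (2 ^ l * fact l)) $ l"
      unfolding S_def by (simp add: fps_compose_uminus')
  qed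
  finally show ?thesis .
qed

lemma sqrt_one_minus_fps_X_power2: "fps_radical root 2 (1 - fps_X) ^ 2 = (1 - fps_X :: real fps)"
  using iffD1[OF power_radical[of "1 - fps_X :: real fps" root 1]] by (simp add: numeral_2_eq_2)

text \<open>
  The series \<open>(1 - T)\<^sup>-\<^sup>1\<^sup>/\<^sup>2 exp(\<beta> T - T\<^sup>2 / (4m))\<close>, written as one composition with \<open>T = T(mz)\<close> so
  that Lagrange inversion applies to the outer series.
\<close>

definition ehrhart_gf :: "real \<Rightarrow> real \<Rightarrow> real fps" where
  "ehrhart_gf m \<beta> = (inverse (fps_radical root 2 (1 - fps_X)) * quadratic_exp \<beta> (- 1 / (4 * m))) oo scaled_tree_fps m"

text \<open>
  The double sum of the closed formula; \<open>m\<close> stands for \<open>bt\<close>, and \<open>s\<close> for the linear factor in \<open>t\<close>.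
\<close>

definition explicit_count :: "nat \<Rightarrow> real \<Rightarrow> real \<Rightarrow> real" where
  "explicit_count n m s = 1 / 2 ^ n *
        (\<Sum>i=0..n div 2. \<Sum>j=2*i..n.
           (-1) ^ (i + 1)
           * (fact n / (fact (n - j) * fact (j - 2 * i) * fact i * fact i))
           * fact i
           * dfact_2m_minus_3 (j - 2 * i)
           * m ^ (j - i)
           * s ^ (n - j))"

text \<open>
  By Lagrange inversion the coefficient is \<open>m\<^sup>n\<close> times that of \<open>u\<^sup>n\<close> in
  \<open>(1 - u)\<^sup>1\<^sup>/\<^sup>2 exp(- u\<^sup>2 / (4m)) exp((\<beta> + n) u)\<close>. In the double sum, \<open>i\<close> is the index in the
  exponential of the square, \<open>j - 2 i\<close> the exponent taken from the square root, and \<open>n - j\<close> the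
  exponent taken from the last factor.
\<close>

lemma ehrhart_gf_eq_egf:
  assumes "m \<noteq> 0"
  shows "ehrhart_gf m \<beta> = egf (\<lambda>n. explicit_count n m (2 * m * (\<beta> + real n)))"
proof (rule fps_ext)
  fix n
  let ?R = "fps_radical root 2 (1 - fps_X) :: real fps"
  let ?\<gamma> = "- 1 / (4 * m)"
  have u: "?R * inverse ?R = 1" by (rule inverse_mult_eq_1') simp
  have "inverse (?R ^ 2) * ?R = inverse ?R * (?R * inverse ?R)"
    unfolding fps_inverse_power by (simp only: power2_eq_square mult_ac)
  then have "inverse (?R ^ 2) * ?R = inverse ?R"
    unfolding u by simp
  then have RJ: "?R * inverse (1 - fps_X) = inverse ?R"
    unfolding sqrt_one_minus_fps_X_power2 by (simp add: mult.commute)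
  have "ehrhart_gf m \<beta> $ n = m ^ n * (((?R * quadratic_exp \<beta> ?\<gamma>) * inverse (1 - fps_X)) oo tree_fps) $ n"
    unfolding ehrhart_gf_def compose_scaled_tree_fps RJ[symmetric] by (simp only: fps_nth_Abs_fps mult_ac)
  also have "\<dots> = m ^ n * (?R * quadratic_exp \<beta> ?\<gamma> * fps_exp (real n)) $ n"
    unfolding lagrange_tree_fps[symmetric] by simp
  also have "?R * quadratic_exp \<beta> ?\<gamma> * fps_exp (real n) = quadratic_exp 0 ?\<gamma> * (?R * fps_exp (\<beta> + real n))"
  proof -
    have "quadratic_exp \<beta> ?\<gamma> * fps_exp (real n) = quadratic_exp 0 ?\<gamma> * fps_exp (\<beta> + real n)"
      by (simp add: fps_exp_eq_quadratic_exp quadratic_exp_mult)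
    then show ?thesis by (simp only: mult.assoc mult.left_commute[of ?R])
  qed
  also have "m ^ n * (quadratic_exp 0 ?\<gamma> * (?R * fps_exp (\<beta> + real n))) $ n =
     (\<Sum>i=0..n div 2. \<Sum>l=0..n - 2 * i. m ^ n * (?\<gamma> ^ i / fact i) * (- dfact_2m_minus_3 l / (2 ^ l * fact l)
         * ((\<beta> + real n) ^ (n - 2 * i - l) / fact (n - 2 * i - l))))"
    unfolding quadratic_exp_0_mult_nth
    unfolding sqrt_one_minus_fps_X fps_mult_nth
    by (simp add: sum_distrib_left mult.assoc)
  also have "\<dots> = (\<Sum>i=0..n div 2. \<Sum>j=2*i..n. 1 / 2 ^ n / fact n * ((-1) ^ (i + 1)
           * (fact n / (fact (n - j) * fact (j - 2 * i) * fact i * fact i))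
           * fact i
           * dfact_2m_minus_3 (j - 2 * i)
           * m ^ (j - i)
           * (2 * m * (\<beta> + real n)) ^ (n - j)))"
  proof (rule sum.cong[OF refl])
    fix i assume "i \<in> {0..n div 2}"
    then have i: "2 * i \<le> n" by auto
    show "(\<Sum>l=0..n - 2 * i. m ^ n * (?\<gamma> ^ i / fact i) * (- dfact_2m_minus_3 l / (2 ^ l * fact l)
         * ((\<beta> + real n) ^ (n - 2 * i - l) / fact (n - 2 * i - l)))) =
       (\<Sum>j=2*i..n. 1 / 2 ^ n / fact n * ((-1) ^ (i + 1)
           * (fact n / (fact (n - j) * fact (j - 2 * i) * fact i * fact i))
           * fact i
           * dfact_2m_minus_3 (j - 2 * i)
           * m ^ (j - i)
           * (2 * m * (\<beta> + real n)) ^ (n - j)))"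
    proof (rule sum.reindex_bij_witness[of _ "\<lambda>j. j - 2 * i" "\<lambda>l. l + 2 * i"])
      fix l assume "l \<in> {0..n - 2 * i}"
      with i have l: "l + 2 * i \<le> n" by auto
      define r where "r = n - (l + 2 * i)"
      have n: "n = i + (l + i) + r" "n = 2 * i + l + r" using l by (auto simp: r_def)
      have r: "n - 2 * i - l = r" "n - (l + 2 * i) = r" "l + 2 * i - i = l + i" using l by (auto simp: r_def)
      have mn: "m ^ n = m ^ i * m ^ (l + i) * m ^ r" by (simp add: n(1) power_add)
      have tn: "(2::real) ^ n = 4 ^ i * 2 ^ l * 2 ^ r" by (simp add: n(2) power_add power_mult)
      have g: "m ^ i * ?\<gamma> ^ i = (-1) ^ i / 4 ^ i"
      proof -
        have "m * ?\<gamma> = - 1 / 4" using assms by simp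
        then have "(m * ?\<gamma>) ^ i = (- 1 / 4) ^ i" by (simp only:)
        also have "\<dots> = (- 1) ^ i / 4 ^ i" by (rule power_divide)
        finally show ?thesis by (simp only: power_mult_distrib)
      qed
      have key: "m ^ n * (?\<gamma> ^ i / fact i) = (-1) ^ i / 4 ^ i * m ^ (l + i) * m ^ r / fact i"
        unfolding mn g[symmetric] by simp
      show "1 / 2 ^ n / fact n * ((-1) ^ (i + 1)
           * (fact n / (fact (n - (l + 2 * i)) * fact (l + 2 * i - 2 * i) * fact i * fact i))
           * fact i
           * dfact_2m_minus_3 (l + 2 * i - 2 * i)
           * m ^ (l + 2 * i - i)
           * (2 * m * (\<beta> + real n)) ^ (n - (l + 2 * i))) =
         m ^ n * (?\<gamma> ^ i / fact i) * (- dfact_2m_minus_3 l / (2 ^ l * fact l)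
         * ((\<beta> + real n) ^ (n - 2 * i - l) / fact (n - 2 * i - l)))"
        unfolding key r tn power_mult_distrib by (simp add: mult_ac)
    qed (use i in auto)
  qed
  also have "\<dots> = explicit_count n m (2 * m * (\<beta> + real n)) / fact n"
    unfolding explicit_count_def sum_distrib_left[symmetric] by simp
  finally show "ehrhart_gf m \<beta> $ n = egf (\<lambda>n. explicit_count n m (2 * m * (\<beta> + real n))) $ n"
    by simp
qed

text \<open>
  The solution is \<open>exp((T - T\<^sup>2 / 2) / m)\<close> because \<open>(1 - T) T' / m = e\<^sup>T\<close>. It is the exponential
  generating function of labelled forests whose edges carry one of \<open>m\<close> colours.
\<close>

lemma exp_tree_ODE_solution:
  assumes "m \<noteq> 0" and P: "fps_deriv P = P * (fps_exp 1 oo scaled_tree_fps m)" "P $ 0 = 1"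
  shows "P = quadratic_exp (1 / m) (- 1 / (2 * m)) oo scaled_tree_fps m"
proof (rule fps_linear_ODE_unique)
  let ?T = "scaled_tree_fps m" and ?G = "quadratic_exp (1 / m) (- 1 / (2 * m))"
  have "fps_deriv ?G = ?G * (fps_const (1 / m) * (1 - fps_X))"
  proof -
    have "fps_deriv (fps_const (1 / m) * fps_X + fps_const (- 1 / (2 * m)) * fps_X ^ 2) = fps_const (1 / m) * (1 - fps_X)"
      by (rule fps_ext) (simp add: power2_eq_square numeral_fps_const)
    then show ?thesis
      unfolding quadratic_exp_def by (subst fps_compose_deriv) simp_all
  qed
  then have "fps_deriv (?G oo ?T) = (?G oo ?T) * (fps_const (1 / m) * (1 - ?T)) * fps_deriv ?T"
    by (simp add: fps_compose_deriv fps_compose_mult_distrib fps_compose_sub_distrib)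
  also have "\<dots> = (?G oo ?T) * fps_const (1 / m) * (fps_deriv ?T * (1 - ?T))"
    by (simp only: mult_ac)
  also have "\<dots> = (?G oo ?T) * (fps_const (1 / m) * fps_const m) * (fps_exp 1 oo ?T)"
    unfolding scaled_tree_fps_deriv by (simp only: mult_ac)
  finally show "fps_deriv (?G oo ?T) = (?G oo ?T) * (fps_exp 1 oo ?T)"
    using assms by simp
qed (use P in simp_all)

text \<open>
  The elimination: the quotient of the second hypothesis by the first determines \<open>P\<close>, then the first
  determines \<open>I\<^sup>2\<close>, then the third determines \<open>N\<^sup>2\<close>. The constant term fixes the sign of \<open>N\<close>.
\<close>

lemma egf_eq_ehrhart_gf:
  assumes "m \<noteq> 0" and I: "I $ 0 = 1" and P: "P $ 0 = 1" and N: "N $ 0 = 1"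
    and IP: "I ^ 2 * P = egf (\<lambda>n. (1 - m + m * real n) ^ n)"
    and IP': "I ^ 2 * fps_deriv P = egf (\<lambda>n. (1 + m * real n) ^ n)"
    and IN: "I * N = egf (\<lambda>n. (c - m + m * real n) ^ n)"
  shows "N = ehrhart_gf m (c / m - 1 / 2)"
proof -
  let ?T = "scaled_tree_fps m" and ?J = "inverse (1 - fps_X) :: real fps"
  let ?Q = quadratic_exp
  have I0: "I ^ 2 \<noteq> 0" using I by auto
  have E1: "I ^ 2 * P = (?Q (1 / m - 1) 0 * ?J) oo ?T"
    using IP assms(1) by (simp add: abel_egf fps_exp_eq_quadratic_exp diff_divide_distrib)
  have E2: "I ^ 2 * fps_deriv P = (?Q (1 / m) 0 * ?J) oo ?T"
    using IP' assms(1) by (simp add: abel_egf fps_exp_eq_quadratic_exp)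
  have Ec: "I * N = (?Q (c / m - 1) 0 * ?J) oo ?T"
    using IN assms(1) by (simp add: abel_egf fps_exp_eq_quadratic_exp diff_divide_distrib)
  have "?Q (1 / m) 0 * ?J = (?Q (1 / m - 1) 0 * ?J) * fps_exp 1"
  proof -
    have "?Q (1 / m - 1) 0 * fps_exp 1 = ?Q (1 / m) 0"
      by (simp add: fps_exp_eq_quadratic_exp quadratic_exp_mult)
    then show ?thesis by (simp only: mult_ac flip: \<open>?Q (1 / m - 1) 0 * fps_exp 1 = ?Q (1 / m) 0\<close>)
  qed
  then have "I ^ 2 * fps_deriv P = I ^ 2 * (P * (fps_exp 1 oo ?T))"
    unfolding E2 mult.assoc[symmetric, of "I ^ 2"] E1
    by (simp only: fps_compose_mult_distrib[OF scaled_tree_fps_nth_0])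
  with I0 have "fps_deriv P = P * (fps_exp 1 oo ?T)" by simp
  from exp_tree_ODE_solution[OF assms(1) this P] have PG: "P = ?Q (1 / m) (- 1 / (2 * m)) oo ?T" .
  let ?E = "?Q (1 / m - 1) 0 * ?J"
  let ?H = "inverse (fps_radical root 2 (1 - fps_X)) * ?Q (c / m - 1 / 2) (- 1 / (4 * m))"
  have H: "?H ^ 2 * ?E = (?Q (c / m - 1) 0 * ?J) ^ 2 * ?Q (1 / m) (- 1 / (2 * m))"
  proof -
    have "inverse (fps_radical root 2 (1 - fps_X)) ^ 2 = ?J"
      unfolding fps_inverse_power[symmetric] sqrt_one_minus_fps_X_power2 ..
    then have "?H ^ 2 * ?E = ?J ^ 2 * (?Q (c / m - 1 / 2) (- 1 / (4 * m)) * ?Q (c / m - 1 / 2) (- 1 / (4 * m)) * ?Q (1 / m - 1) 0)"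
      unfolding power_mult_distrib by (simp only: power2_eq_square mult_ac)
    also have "\<dots> = ?J ^ 2 * (?Q (c / m - 1) 0 * ?Q (c / m - 1) 0 * ?Q (1 / m) (- 1 / (2 * m)))"
    proof -
      have e: "c / m - 1 / 2 + (c / m - 1 / 2) + (1 / m - 1) = c / m - 1 + (c / m - 1) + 1 / m"
        "- 1 / (4 * m) + - 1 / (4 * m) + 0 = 0 + 0 + - 1 / (2 * m)" by simp_all
      show ?thesis unfolding quadratic_exp_mult e ..
    qed
    finally show ?thesis by (simp only: power_mult_distrib power2_eq_square mult_ac)
  qed
  have "N ^ 2 * (?E oo ?T) = (I * N) ^ 2 * P"
    unfolding E1[symmetric] by (simp only: power_mult_distrib mult_ac)
  also have "\<dots> = ((?Q (c / m - 1) 0 * ?J) ^ 2 * ?Q (1 / m) (- 1 / (2 * m))) oo ?T"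
    unfolding Ec PG fps_compose_power[OF scaled_tree_fps_nth_0]
    by (rule fps_compose_mult_distrib[OF scaled_tree_fps_nth_0, symmetric])
  also have "\<dots> = (?H oo ?T) ^ 2 * (?E oo ?T)"
    unfolding H[symmetric] fps_compose_power[OF scaled_tree_fps_nth_0]
    by (rule fps_compose_mult_distrib[OF scaled_tree_fps_nth_0])
  finally have "N ^ 2 * (?E oo ?T) = (?H oo ?T) ^ 2 * (?E oo ?T)" .
  moreover have "(?E oo ?T) $ 0 \<noteq> 0" by simp
  then have "?E oo ?T \<noteq> 0" by fastforce
  ultimately have "N ^ 2 = (?H oo ?T) ^ 2" by simp
  then have "N = ?H oo ?T \<or> N = - (?H oo ?T)" by (rule power2_eq_iff[THEN iffD1])
  moreover have "N $ 0 \<noteq> (- (?H oo ?T)) $ 0" using N by simp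
  then have "N \<noteq> - (?H oo ?T)" by metis
  ultimately show ?thesis unfolding ehrhart_gf_def by blast
qed

section \<open>Integer points whose coordinate sums are bounded\<close>

text \<open>
  All point sets that are counted have this form: the bounds depend only on the size of \<open>S\<close>. The
  empty set is exempt so that a strict upper bound can be expressed by subtracting \<open>1\<close>.
\<close>

definition bounded_points :: "(nat \<Rightarrow> int) \<Rightarrow> (nat \<Rightarrow> int) \<Rightarrow> nat set \<Rightarrow> (nat \<Rightarrow> int) set" where
  "bounded_points lo up V = {y \<in> V \<rightarrow>\<^sub>E UNIV. \<forall>S\<subseteq>V. S \<noteq> {} \<longrightarrow> lo (card S) \<le> sum y S \<and> sum y S \<le> up (card S)}"

lemma bounded_points_sum:
  assumes "y \<in> bounded_points lo up V" "S \<subseteq> V" "S \<noteq> {}"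
  shows "lo (card S) \<le> sum y S" "sum y S \<le> up (card S)"
  using assms unfolding bounded_points_def by auto

lemma bounded_points_coordinate:
  assumes "y \<in> bounded_points lo up V" "i \<in> V"
  shows "lo 1 \<le> y i" "y i \<le> up 1"
  using bounded_points_sum[OF assms(1), of "{i}"] assms(2) by auto

lemma finite_bounded_points:
  assumes "finite V"
  shows "finite (bounded_points lo up V)"
proof (rule finite_subset)
  show "bounded_points lo up V \<subseteq> V \<rightarrow>\<^sub>E {lo 1..up 1}"
  proof
    fix y assume y: "y \<in> bounded_points lo up V"
    then have "y \<in> V \<rightarrow>\<^sub>E UNIV" by (simp add: bounded_points_def)
    with bounded_points_coordinate[OF y] show "y \<in> V \<rightarrow>\<^sub>E {lo 1..up 1}"
      by (auto simp: PiE_iff)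
  qed
  show "finite (V \<rightarrow>\<^sub>E {lo 1..up 1})" using assms by (intro finite_PiE) auto
qed

lemma card_bounded_points_le:
  assumes "finite V" and \<phi>: "bij_betw \<phi> V W"
  shows "card (bounded_points lo up W) \<le> card (bounded_points lo up V)"
proof (rule card_inj_on_le)
  show "inj_on (\<lambda>y. restrict (y \<circ> \<phi>) V) (bounded_points lo up W)"
  proof (rule inj_onI)
    fix y y' assume yy: "y \<in> bounded_points lo up W" "y' \<in> bounded_points lo up W"
      and eq: "restrict (y \<circ> \<phi>) V = restrict (y' \<circ> \<phi>) V"
    have "y j = y' j" if "j \<in> W" for j
    proof -
      from that \<phi> obtain i where "i \<in> V" "j = \<phi> i" by (auto simp: bij_betw_def)
      with fun_cong[OF eq, of i] show ?thesis by simp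
    qed
    then show "y = y'" using yy by (auto simp: bounded_points_def intro: PiE_ext)
  qed
  show "(\<lambda>y. restrict (y \<circ> \<phi>) V) ` bounded_points lo up W \<subseteq> bounded_points lo up V"
  proof clarify
    fix y assume y: "y \<in> bounded_points lo up W"
    have "lo (card S) \<le> sum (restrict (y \<circ> \<phi>) V) S \<and> sum (restrict (y \<circ> \<phi>) V) S \<le> up (card S)"
      if S: "S \<subseteq> V" "S \<noteq> {}" for S
    proof -
      have inj: "inj_on \<phi> S" using \<phi> S by (auto simp: bij_betw_def intro: inj_on_subset)
      have "sum (restrict (y \<circ> \<phi>) V) S = sum y (\<phi> ` S)"
        unfolding sum.reindex[OF inj] using S by (intro sum.cong) auto
      moreover have "\<phi> ` S \<subseteq> W" "\<phi> ` S \<noteq> {}" using S \<phi> by (auto simp: bij_betw_def)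
      ultimately show ?thesis
        using bounded_points_sum[OF y, of "\<phi> ` S"] card_image[OF inj] by simp
    qed
    then show "restrict (y \<circ> \<phi>) V \<in> bounded_points lo up V"
      by (auto simp: bounded_points_def)
  qed
qed (rule finite_bounded_points[OF assms(1)])

lemma card_bounded_points_eq_card:
  assumes "finite V" "finite W" "card V = card W"
  shows "card (bounded_points lo up V) = card (bounded_points lo up W)"
proof -
  obtain \<phi> where \<phi>: "bij_betw \<phi> V W" using finite_same_card_bij assms by blast
  show ?thesis
    using card_bounded_points_le[OF assms(1) \<phi>] card_bounded_points_le[OF assms(2) bij_betw_inv_into[OF \<phi>]]
    by (intro antisym)
qed

lemma card_bounded_points_reflect:
  "card (bounded_points (\<lambda>s. M * int s - up s) (\<lambda>s. M * int s - lo s) V) = card (bounded_points lo up V)"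
proof -
  let ?r = "\<lambda>y. \<lambda>i\<in>V. M - y i"
  have map: "?r y \<in> bounded_points (\<lambda>s. M * int s - up s) (\<lambda>s. M * int s - lo s) V"
    if y: "y \<in> bounded_points lo up V" for y lo up
  proof -
    have "sum (?r y) S = M * int (card S) - sum y S" if "S \<subseteq> V" for S
    proof -
      have "sum (?r y) S = (\<Sum>i\<in>S. M - y i)" using that by (intro sum.cong) auto
      then show ?thesis by (simp add: sum_subtractf)
    qed
    with bounded_points_sum[OF y] show ?thesis by (auto simp: bounded_points_def)
  qed
  have invol: "?r (?r y) = y" if "y \<in> bounded_points lo up V" for y lo up
    using that by (auto simp: bounded_points_def fun_eq_iff PiE_iff extensional_def)
  have "bij_betw ?r (bounded_points (\<lambda>s. M * int s - up s) (\<lambda>s. M * int s - lo s) V) (bounded_points lo up V)"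
  proof (rule bij_betw_byWitness[where f' = ?r])
    show "?r ` bounded_points (\<lambda>s. M * int s - up s) (\<lambda>s. M * int s - lo s) V \<subseteq> bounded_points lo up V"
      using map[of _ "\<lambda>s. M * int s - up s" "\<lambda>s. M * int s - lo s"] by auto
  qed (use map invol in auto)
  then show ?thesis by (rule bij_betw_same_card)
qed

text \<open>
  A translation is the composition of two reflections.
\<close>

lemma card_bounded_points_translate:
  "card (bounded_points (\<lambda>s. lo s + d * int s) (\<lambda>s. up s + d * int s) V) = card (bounded_points lo up V)"
  using card_bounded_points_reflect[of d "\<lambda>s. - lo s" "\<lambda>s. - up s"]
    card_bounded_points_reflect[of 0 up lo] by (simp add: add.commute)

lemma card_restrict_product:
  assumes "U \<subseteq> V" "A \<subseteq> U \<rightarrow>\<^sub>E UNIV" "B \<subseteq> (V - U) \<rightarrow>\<^sub>E UNIV"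
  shows "card {y \<in> V \<rightarrow>\<^sub>E UNIV. restrict y U \<in> A \<and> restrict y (V - U) \<in> B} = card A * card B"
proof -
  let ?X = "{y \<in> V \<rightarrow>\<^sub>E UNIV. restrict y U \<in> A \<and> restrict y (V - U) \<in> B}"
  let ?f = "\<lambda>y. (restrict y U, restrict y (V - U))"
  let ?g = "\<lambda>(a, b) i. if i \<in> U then a i else b i"
  have "bij_betw ?f ?X (A \<times> B)"
  proof (rule bij_betw_byWitness[where f' = ?g])
    show "\<forall>y\<in>?X. ?g (?f y) = y"
      using assms(1) by (auto simp: fun_eq_iff PiE_iff extensional_def)
    have fg: "?f (?g p) = p" if "p \<in> A \<times> B" for p
      using that assms by (auto simp: fun_eq_iff PiE_iff extensional_def split: prod.splits dest!: subsetD)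
    then show "\<forall>p\<in>A \<times> B. ?f (?g p) = p" by blast
    show "?f ` ?X \<subseteq> A \<times> B" by auto
    show "?g ` (A \<times> B) \<subseteq> ?X"
    proof
      fix y assume "y \<in> ?g ` (A \<times> B)"
      then obtain p where p: "p \<in> A \<times> B" "y = ?g p" by blast
      have "y \<in> V \<rightarrow>\<^sub>E UNIV"
      proof -
        obtain a b where "p = (a, b)" "a \<in> U \<rightarrow>\<^sub>E UNIV" "b \<in> (V - U) \<rightarrow>\<^sub>E UNIV"
          using p(1) assms by blast
        with p(2) assms(1) show ?thesis by (auto simp: PiE_iff extensional_def)
      qed
      moreover have "?f y \<in> A \<times> B" using fg[OF p(1)] p by simp
      ultimately show "y \<in> ?X" by simp
    qed
  qed
  then show ?thesis by (simp add: bij_betw_same_card card_cartesian_product)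
qed

text \<open>
  The inclusion-least set among the maximizers of \<open>h\<close>, described by comparisons with its subsets and
  supersets only. For supermodular \<open>h\<close> this description suffices, and in this form it splits
  into a condition inside \<open>U\<close> and a condition outside \<open>U\<close>.
\<close>

definition least_maximizer :: "(nat set \<Rightarrow> int) \<Rightarrow> nat set \<Rightarrow> nat set \<Rightarrow> bool" where
  "least_maximizer h V U \<longleftrightarrow> (\<forall>W. W \<subset> U \<longrightarrow> h W < h U) \<and> (\<forall>W. U \<subseteq> W \<longrightarrow> W \<subseteq> V \<longrightarrow> h W \<le> h U)"

text \<open>
  A maximizer of least cardinality exists. If \<open>A\<close> and \<open>B\<close> both qualify and \<open>A\<close> is not contained in \<open>B\<close>,
  then \<open>h(A \<inter> B) < h(A)\<close> and \<open>h(A \<union> B) \<le> h(B)\<close>, against supermodularity.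
\<close>

lemma ex1_least_maximizer:
  assumes "finite V" and super: "\<And>A B. A \<subseteq> V \<Longrightarrow> B \<subseteq> V \<Longrightarrow> h A + h B \<le> h (A \<union> B) + h (A \<inter> B)"
  shows "\<exists>!U. U \<subseteq> V \<and> least_maximizer h V U"
proof (rule ex_ex1I)
  define M where "M = Max (h ` Pow V)"
  have fin: "finite (h ` Pow V)" using assms(1) by simp
  have le: "h W \<le> M" if "W \<subseteq> V" for W unfolding M_def by (rule Max_ge) (use that fin in auto)
  have "M \<in> h ` Pow V" unfolding M_def by (rule Max_in) (use fin in auto)
  then obtain U0 where "U0 \<subseteq> V \<and> h U0 = M" by auto
  from ex_has_least_nat[of "\<lambda>U. U \<subseteq> V \<and> h U = M", OF this, of card]
  obtain U where U: "U \<subseteq> V" "h U = M" and min: "\<forall>W. W \<subseteq> V \<and> h W = M \<longrightarrow> card U \<le> card W"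
    by blast
  have "h W < h U" if "W \<subset> U" for W
  proof -
    have "finite U" using U(1) assms(1) by (rule finite_subset)
    then have "card W < card U" using that by (rule psubset_card_mono)
    have "W \<subseteq> V" using that U(1) by auto
    have "h W \<noteq> M"
    proof
      assume "h W = M"
      with min \<open>W \<subseteq> V\<close> have "card U \<le> card W" by blast
      with \<open>card W < card U\<close> show False by simp
    qed
    with U(2) le[OF \<open>W \<subseteq> V\<close>] show ?thesis by simp
  qed
  moreover have "h W \<le> h U" if "W \<subseteq> V" for W using le[OF that] U(2) by simp
  ultimately have "U \<subseteq> V \<and> least_maximizer h V U" using U(1) by (simp add: least_maximizer_def)
  then show "\<exists>U. U \<subseteq> V \<and> least_maximizer h V U" ..
next
  fix U U' assume U: "U \<subseteq> V \<and> least_maximizer h V U" "U' \<subseteq> V \<and> least_maximizer h V U'"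
  have sub: "A \<subseteq> B" if "A \<subseteq> V \<and> least_maximizer h V A" "B \<subseteq> V \<and> least_maximizer h V B" for A B
  proof (rule ccontr)
    assume "\<not> A \<subseteq> B"
    then have "A \<inter> B \<subset> A" by auto
    then have "h (A \<inter> B) < h A" using that by (simp add: least_maximizer_def)
    moreover have "h (A \<union> B) \<le> h B" using that by (simp add: least_maximizer_def)
    ultimately show False using super[OF conjunct1[OF that(1)] conjunct1[OF that(2)]] by linarith
  qed
  show "U = U'" using sub[OF U(1) U(2)] sub[OF U(2) U(1)] by (rule equalityI)
qed

lemma card_partition_by_least_maximizer:
  assumes "finite V" "finite X"
    and super: "\<And>y A B. y \<in> X \<Longrightarrow> A \<subseteq> V \<Longrightarrow> B \<subseteq> V \<Longrightarrow> h y A + h y B \<le> h y (A \<union> B) + h y (A \<inter> B)"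
  shows "card X = (\<Sum>U\<in>Pow V. card {y \<in> X. least_maximizer (h y) V U})"
proof -
  have ex1: "\<exists>!U. U \<subseteq> V \<and> least_maximizer (h y) V U" if "y \<in> X" for y
    by (rule ex1_least_maximizer[OF assms(1) super[OF that]])
  have "card X = card (\<Union>U\<in>Pow V. {y \<in> X. least_maximizer (h y) V U})"
  proof (rule arg_cong[where f = card])
    show "X = (\<Union>U\<in>Pow V. {y \<in> X. least_maximizer (h y) V U})"
    proof (intro equalityI subsetI)
      fix y assume y: "y \<in> X"
      obtain U where "U \<subseteq> V" "least_maximizer (h y) V U"
        using ex1_implies_ex[OF ex1[OF y]] by blast
      with y show "y \<in> (\<Union>U\<in>Pow V. {y \<in> X. least_maximizer (h y) V U})" by auto
    qed auto
  qed
  also have "\<dots> = (\<Sum>U\<in>Pow V. card {y \<in> X. least_maximizer (h y) V U})"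
  proof (rule card_UN_disjoint)
    show "\<forall>U\<in>Pow V. \<forall>U'\<in>Pow V. U \<noteq> U' \<longrightarrow> {y \<in> X. least_maximizer (h y) V U} \<inter> {y \<in> X. least_maximizer (h y) V U'} = {}"
    proof (intro ballI impI)
      fix U U' assume U: "U \<in> Pow V" "U' \<in> Pow V" "U \<noteq> U'"
      have False if y: "y \<in> X" "least_maximizer (h y) V U" "least_maximizer (h y) V U'" for y
        using ex1[OF y(1)] y(2,3) U by auto
      then show "{y \<in> X. least_maximizer (h y) V U} \<inter> {y \<in> X. least_maximizer (h y) V U'} = {}" by auto
    qed
  qed (use assms in auto)
  finally show ?thesis .
qed

text \<open>
  Replacing a subset \<open>W\<close> of \<open>U\<close> by \<open>U - W\<close> and a superset \<open>W\<close> by \<open>W - U\<close>, the first condition involves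
  only \<open>y\<close> on \<open>U\<close> and the second only \<open>y\<close> outside \<open>U\<close>: the two parts of \<open>y\<close> become independent.
\<close>

lemma least_maximizer_iff:
  fixes y :: "nat \<Rightarrow> int" and q :: "nat \<Rightarrow> int"
  assumes "finite V" "U \<subseteq> V"
  shows "least_maximizer (\<lambda>S. sum y S + q (card S)) V U \<longleftrightarrow>
    (\<forall>S\<subseteq>U. S \<noteq> {} \<longrightarrow> sum y S > q (card U - card S) - q (card U)) \<and>
    (\<forall>S\<subseteq>V - U. S \<noteq> {} \<longrightarrow> sum y S \<le> q (card U) - q (card U + card S))"
proof -
  have fU: "finite U" using assms finite_subset by blast
  have "(\<forall>W. W \<subset> U \<longrightarrow> sum y W + q (card W) < sum y U + q (card U)) \<longleftrightarrow>
      (\<forall>S\<subseteq>U. S \<noteq> {} \<longrightarrow> sum y S > q (card U - card S) - q (card U))" (is "?L \<longleftrightarrow> ?R")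
  proof -
    have 1: "sum y (U - S) = sum y U - sum y S" "card (U - S) = card U - card S" if "S \<subseteq> U" for S
      using that fU by (auto simp: sum_diff card_Diff_subset finite_subset)
    show ?thesis
    proof
      assume ?L
      show ?R
      proof (intro allI impI)
        fix S assume S: "S \<subseteq> U" "S \<noteq> {}"
        then have "U - S \<subset> U" by auto
        with \<open>?L\<close> have "sum y (U - S) + q (card (U - S)) < sum y U + q (card U)" by blast
        then show "sum y S > q (card U - card S) - q (card U)" using 1[OF S(1)] by simp
      qed
    next
      assume ?R
      show ?L
      proof (intro allI impI)
        fix W assume W: "W \<subset> U"
        then have "U - W \<subseteq> U" "U - W \<noteq> {}" by auto
        with \<open>?R\<close> have *: "sum y (U - W) > q (card U - card (U - W)) - q (card U)" by blast
        have "card W \<le> card U" using W fU by (simp add: card_mono)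
        then show "sum y W + q (card W) < sum y U + q (card U)" using * 1[of W] W by auto
      qed
    qed
  qed
  moreover have "(\<forall>W. U \<subseteq> W \<longrightarrow> W \<subseteq> V \<longrightarrow> sum y W + q (card W) \<le> sum y U + q (card U)) \<longleftrightarrow>
      (\<forall>S\<subseteq>V - U. S \<noteq> {} \<longrightarrow> sum y S \<le> q (card U) - q (card U + card S))" (is "?L \<longleftrightarrow> ?R")
  proof -
    have 1: "sum y (U \<union> S) = sum y U + sum y S" "card (U \<union> S) = card U + card S" if "S \<subseteq> V - U" for S
    proof -
      have "finite S" "U \<inter> S = {}" using that assms by (auto intro: finite_subset[of S V])
      then show "sum y (U \<union> S) = sum y U + sum y S" "card (U \<union> S) = card U + card S"
        using fU by (auto simp: sum.union_disjoint card_Un_disjoint)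
    qed
    show ?thesis
    proof
      assume ?L
      show ?R
      proof (intro allI impI)
        fix S assume S: "S \<subseteq> V - U" "S \<noteq> {}"
        then have "U \<subseteq> U \<union> S" "U \<union> S \<subseteq> V" using assms by auto
        with \<open>?L\<close> have "sum y (U \<union> S) + q (card (U \<union> S)) \<le> sum y U + q (card U)" by blast
        then show "sum y S \<le> q (card U) - q (card U + card S)" using 1[OF S(1)] by simp
      qed
    next
      assume ?R
      show ?L
      proof (intro allI impI)
        fix W assume W: "U \<subseteq> W" "W \<subseteq> V"
        then have S: "W - U \<subseteq> V - U" "U \<union> (W - U) = W" by auto
        show "sum y W + q (card W) \<le> sum y U + q (card U)"
        proof (cases "W - U = {}")
          case True
          with S W have "W = U" by auto
          then show ?thesis by simp
        next
          case False
          with \<open>?R\<close> S have "sum y (W - U) \<le> q (card U) - q (card U + card (W - U))" by blast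
          then show ?thesis using 1[OF S(1)] S(2) by simp
        qed
      qed
    qed
  qed
  ultimately show ?thesis by (simp add: least_maximizer_def)
qed

lemma sum_Pow_card:
  fixes F :: "nat \<Rightarrow> nat"
  assumes "finite V"
  shows "(\<Sum>U\<in>Pow V. F (card U)) = (\<Sum>k\<le>card V. (card V choose k) * F k)"
proof -
  have "(\<Sum>U\<in>Pow V. F (card U)) = (\<Sum>k\<le>card V. \<Sum>U\<in>{U \<in> Pow V. card U = k}. F (card U))"
    by (rule sum.group[symmetric]) (use assms in \<open>auto simp: card_mono\<close>)
  also have "\<dots> = (\<Sum>k\<le>card V. (card V choose k) * F k)"
    using n_subsets[OF assms] by (intro sum.cong refl) (simp add: Pow_def)
  finally show ?thesis .
qed

text \<open>
  The number of edges of the complete graph \<open>K\<^sub>n\<close> that meet a given set of \<open>s \<le> n\<close> vertices.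
\<close>

definition edges_meeting :: "nat \<Rightarrow> nat \<Rightarrow> int" where
  "edges_meeting n s = int (n choose 2) - int ((n - s) choose 2)"

lemma twice_choose_two: "2 * int (n choose 2) = int n * (int n - 1)"
proof -
  have "2 * (n choose 2) = n * (n - 1)" using dvd_mult_div_cancel[of 2 "n * (n - 1)"]
    by (cases n) (simp_all add: choose_two)
  then have "2 * int (n choose 2) = int (n * (n - 1))" by linarith
  then show ?thesis by (cases n) (simp_all add: algebra_simps)
qed

lemma twice_edges_meeting: "s \<le> n \<Longrightarrow> 2 * edges_meeting n s = int s * (2 * int n - int s - 1)"
  unfolding edges_meeting_def right_diff_distrib twice_choose_two
  by (simp add: of_nat_diff algebra_simps)

lemma restrict_mem_bounded_points_iff:
  assumes "U \<subseteq> V"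
  shows "restrict y U \<in> bounded_points lo up U \<longleftrightarrow>
    (\<forall>S\<subseteq>U. S \<noteq> {} \<longrightarrow> lo (card S) \<le> sum y S \<and> sum y S \<le> up (card S))"
proof -
  have "sum (restrict y U) S = sum y S" if "S \<subseteq> U" for S
    using that by (intro sum.cong) auto
  then show ?thesis by (auto simp: bounded_points_def)
qed

section \<open>Three identities between the point counts\<close>

definition bounded_point_count :: "(nat \<Rightarrow> int) \<Rightarrow> (nat \<Rightarrow> int) \<Rightarrow> nat \<Rightarrow> nat" where
  "bounded_point_count lo up n = card (bounded_points lo up {..<n})"

lemma card_bounded_points_eq_bounded_point_count:
  "finite V \<Longrightarrow> card (bounded_points lo up V) = bounded_point_count lo up (card V)"
  unfolding bounded_point_count_def by (rule card_bounded_points_eq_card) auto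

definition polymatroid_count :: "int \<Rightarrow> int \<Rightarrow> nat \<Rightarrow> nat" where
  "polymatroid_count m c n = bounded_point_count (\<lambda>_. 0) (\<lambda>s. (c - 1) * int s + m * edges_meeting n s) n"

text \<open>
  The upper bounds are the strict versions of those of \<open>polymatroid_count m 1\<close>.
\<close>

definition interior_count :: "int \<Rightarrow> nat \<Rightarrow> nat" where
  "interior_count m n = bounded_point_count (\<lambda>_. 0) (\<lambda>s. m * edges_meeting n s - 1) n"

text \<open>
  Lattice points of a graphical zonotope, the Minkowski sum of \<open>m\<close> copies of each segment from \<open>e\<^sub>i\<close> to
  \<open>e\<^sub>j\<close> and \<open>l\<close> copies of each segment from \<open>0\<close> to \<open>e\<^sub>i\<close>: a set \<open>S\<close> receives at least the contributions of
  the segments inside it, and at most those of all segments that meet it.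
\<close>

definition zonotope_count :: "int \<Rightarrow> int \<Rightarrow> nat \<Rightarrow> nat" where
  "zonotope_count m l n = bounded_point_count (\<lambda>s. m * int (s choose 2)) (\<lambda>s. l * int s + m * edges_meeting n s) n"

text \<open>
  Identities between binomial coefficients \<open>binom(s, 2)\<close> become polynomial identities after doubling.
\<close>

lemma int_eq_by_doubling: "2 * a = 2 * b \<Longrightarrow> a = (b :: int)" by simp

lemma choose_two_add: "int ((u + s) choose 2) = int (u choose 2) + int (s choose 2) + int u * int s"
  by (rule int_eq_by_doubling) (simp only: distrib_left twice_choose_two of_nat_add, simp add: algebra_simps)

lemma edges_meeting_diff:
  assumes "s \<le> u" "u \<le> n"
  shows "edges_meeting n u - edges_meeting n (u - s) = int s * (int n - 1) - edges_meeting u s"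
  by (rule int_eq_by_doubling)
     (use assms in \<open>simp add: right_diff_distrib twice_edges_meeting of_nat_diff, simp add: algebra_simps\<close>)

lemma edges_meeting_add:
  "edges_meeting n (u + s) - edges_meeting n u = edges_meeting (n - u) s"
  by (simp add: edges_meeting_def)

lemma edges_meeting_restrict:
  assumes "u + s \<le> n"
  shows "edges_meeting n s = edges_meeting (n - u) s + int u * int s"
  by (rule int_eq_by_doubling)
     (use assms in \<open>simp add: distrib_left twice_edges_meeting of_nat_diff, simp add: algebra_simps\<close>)

text \<open>
  Let \<open>U\<close> be a set of \<open>u\<close> vertices that contains a first set, of size \<open>s\<close>, and is disjoint from a second
  set, of size \<open>s'\<close>. Edges inside \<open>U\<close> that meet the first set do not meet the second one, so the left
  side counts different edges that meet the union.
\<close>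

lemma edges_meeting_split:
  assumes "s \<le> u" "u + s' \<le> n"
  shows "edges_meeting u s + edges_meeting n s' \<le> edges_meeting n (s + s')"
proof -
  define p where "p = int s * (int n - int u - int s')"
  have "2 * (edges_meeting u s + edges_meeting n s') + 2 * p = 2 * edges_meeting n (s + s')"
    unfolding p_def using assms by (simp add: distrib_left twice_edges_meeting of_nat_diff, simp add: algebra_simps)
  moreover have "0 \<le> p" unfolding p_def using assms by simp
  ultimately have "2 * (edges_meeting u s + edges_meeting n s') \<le> 2 * edges_meeting n (s + s')"
    by (metis add_increasing2 add_le_cancel_left le_add_same_cancel1 mult_nonneg_nonneg zero_le_numeral)
  then show ?thesis by (simp only: mult_le_cancel_left_pos zero_less_numeral)
qed

lemma edges_meeting_1: "1 \<le> n \<Longrightarrow> edges_meeting n 1 = int n - 1"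
  using twice_edges_meeting[of 1 n] by simp

lemma edges_meeting_0 [simp]: "edges_meeting n 0 = 0"
  by (simp add: edges_meeting_def)

lemma card_Un_Int_nat:
  assumes "finite A" "finite B"
  shows "\<exists>a b d. card A = a + d \<and> card B = b + d \<and> card (A \<union> B) = a + b + d \<and> card (A \<inter> B) = d"
proof (intro exI conjI)
  let ?d = "card (A \<inter> B)"
  show "card A = card (A - B) + ?d" "card B = card (B - A) + ?d"
    using assms by (metis card_Diff_subset_Int card_mono finite_Int inf_le1 inf.commute le_add_diff_inverse2)+
  then show "card (A \<union> B) = card (A - B) + card (B - A) + ?d"
    using card_Un_Int[OF assms] by simp
qed simp

lemma choose_two_supermodular:
  assumes "finite A" "finite B"
  shows "int (card A choose 2) + int (card B choose 2) \<le> int (card (A \<union> B) choose 2) + int (card (A \<inter> B) choose 2)"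
proof -
  obtain a b d where c: "card A = a + d" "card B = b + d" "card (A \<union> B) = a + b + d" "card (A \<inter> B) = d"
    using card_Un_Int_nat[OF assms] by blast
  show ?thesis unfolding c by (simp add: choose_two_add algebra_simps)
qed

text \<open>
  Taking complements turns this into the supermodularity of \<open>binom(s, 2)\<close>.
\<close>

lemma edges_meeting_submodular:
  assumes "finite V" "A \<subseteq> V" "B \<subseteq> V"
  shows "edges_meeting (card V) (card (A \<union> B)) + edges_meeting (card V) (card (A \<inter> B)) \<le>
    edges_meeting (card V) (card A) + edges_meeting (card V) (card B)"
proof -
  have fin: "finite A" "finite B" using assms finite_subset by blast+
  have c: "card V - card W = card (V - W)" if "W \<subseteq> V" for W
    using that assms(1) by (simp add: card_Diff_subset finite_subset)
  have "int (card (V - A) choose 2) + int (card (V - B) choose 2) \<le>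
      int (card (V - (A \<inter> B)) choose 2) + int (card (V - (A \<union> B)) choose 2)"
    using choose_two_supermodular[of "V - A" "V - B"] assms(1) by (simp add: Diff_Int Diff_Un)
  moreover have "A \<union> B \<subseteq> V" "A \<inter> B \<subseteq> V" using assms by auto
  ultimately show ?thesis using assms by (simp add: edges_meeting_def c)
qed

lemma sum_union_inter_int:
  fixes y :: "nat \<Rightarrow> int"
  assumes "finite A" "finite B"
  shows "sum y A + sum y B = sum y (A \<union> B) + sum y (A \<inter> B)"
  using sum.union_inter[OF assms, of y] by simp

text \<open>
  The right-hand side counts the integer points of the cube \<open>{0..M}\<^sup>n\<close>, where \<open>M = c - 1 + m(n - 1)\<close>
  is the largest value that the polymatroid allows for a single coordinate. Let \<open>U\<close> be the set on
  which \<open>y\<close> violates the polymatroid inequalities most, the least maximizer of \<open>y(S) - f(|S|)\<close>.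
  Outside \<open>U\<close> the point \<open>y\<close> lies in the smaller polymatroid. Inside \<open>U\<close> it exceeds certain bounds
  strictly, and the reflection \<open>M - y\<close> turns these into the strict inequalities counted by
  \<open>interior_count\<close>.
\<close>

lemma polymatroid_interior_convolution:
  assumes m: "m \<ge> 1" and c: "c \<ge> 1"
  shows "(\<Sum>k\<le>n. (n choose k) * interior_count m k * polymatroid_count m c (n - k)) = nat ((c + m * (int n - 1)) ^ n)"
proof -
  define V where "V = {..<n}"
  define M where "M = c - 1 + m * (int n - 1)"
  define f where "f s = (c - 1) * int s + m * edges_meeting n s" for s
  define X where "X = V \<rightarrow>\<^sub>E {0..M}"
  have V: "finite V" "card V = n" by (auto simp: V_def)
  have finX: "finite X" unfolding X_def using V by (intro finite_PiE) auto
  have "card X = (\<Sum>U\<in>Pow V. card {y \<in> X. least_maximizer (\<lambda>S. sum y S + - f (card S)) V U})"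
  proof (rule card_partition_by_least_maximizer[OF V(1) finX])
    fix y :: "nat \<Rightarrow> int" and A B assume AB: "A \<subseteq> V" "B \<subseteq> V"
    then have fin: "finite A" "finite B" using V finite_subset by blast+
    have "f (card (A \<union> B)) + f (card (A \<inter> B)) \<le> f (card A) + f (card B)"
    proof -
      have "m * (edges_meeting n (card (A \<union> B)) + edges_meeting n (card (A \<inter> B))) \<le>
          m * (edges_meeting n (card A) + edges_meeting n (card B))"
        using edges_meeting_submodular[OF V(1) AB] V m by (simp add: mult_left_mono)
      moreover have "(c - 1) * int (card (A \<union> B)) + (c - 1) * int (card (A \<inter> B)) = (c - 1) * int (card A) + (c - 1) * int (card B)"
        using card_Un_Int[OF fin] by (metis distrib_left of_nat_add)
      ultimately show ?thesis unfolding f_def by (simp add: distrib_left)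
    qed
    then show "sum y A + - f (card A) + (sum y B + - f (card B)) \<le>
       sum y (A \<union> B) + - f (card (A \<union> B)) + (sum y (A \<inter> B) + - f (card (A \<inter> B)))"
      using sum_union_inter_int[OF fin, of y] by linarith
  qed
  also have "\<dots> = (\<Sum>U\<in>Pow V. interior_count m (card U) * polymatroid_count m c (n - card U))"
  proof (rule sum.cong[OF refl])
    fix U assume "U \<in> Pow V"
    then have U: "U \<subseteq> V" "finite U" using V finite_subset by auto
    define u where "u = card U"
    have un: "u \<le> n" using U V card_mono unfolding u_def by blast
    have cVU: "card (V - U) = n - u" using U V by (simp add: card_Diff_subset u_def)
    let ?A = "bounded_points (\<lambda>s. M * int s - (m * edges_meeting u s - 1)) (\<lambda>s. M * int s - 0) U"
    let ?B = "bounded_points (\<lambda>_. 0) (\<lambda>s. (c - 1) * int s + m * edges_meeting (n - u) s) (V - U)"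
    have lowerA: "M * int s - m * edges_meeting u s = f u - f (u - s)" if "s \<le> u" for s
    proof -
      have "f u - f (u - s) = (c - 1) * int s + m * (edges_meeting n u - edges_meeting n (u - s))"
        using that by (simp add: f_def of_nat_diff algebra_simps)
      then show ?thesis unfolding edges_meeting_diff[OF that un] M_def by (simp add: algebra_simps)
    qed
    have upperB: "(c - 1) * int s + m * edges_meeting (n - u) s = f (u + s) - f u" for s
      unfolding edges_meeting_add[symmetric] f_def by (simp add: algebra_simps)
    note lmi = least_maximizer_iff[OF V(1) U(1), of _ "\<lambda>s. - f s", folded u_def]
    have eq: "y \<in> X \<and> least_maximizer (\<lambda>S. sum y S + - f (card S)) V U \<longleftrightarrow>
        y \<in> V \<rightarrow>\<^sub>E UNIV \<and> restrict y U \<in> ?A \<and> restrict y (V - U) \<in> ?B" (is "?L \<longleftrightarrow> ?R") for y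
    proof
      assume L: ?L
      then have y: "y \<in> V \<rightarrow>\<^sub>E UNIV" "\<And>i. i \<in> V \<Longrightarrow> 0 \<le> y i" "\<And>i. i \<in> V \<Longrightarrow> y i \<le> M" by (auto simp: X_def PiE_iff)
      have lm: "\<And>S. S \<subseteq> U \<Longrightarrow> S \<noteq> {} \<Longrightarrow> sum y S > f u - f (u - card S)"
        "\<And>S. S \<subseteq> V - U \<Longrightarrow> S \<noteq> {} \<Longrightarrow> sum y S \<le> f (u + card S) - f u"
        using L unfolding lmi by (simp, simp)
      have "restrict y U \<in> ?A"
        unfolding restrict_mem_bounded_points_iff[OF U(1)]
      proof (intro allI impI conjI)
        fix S assume S: "S \<subseteq> U" "S \<noteq> {}"
        then have "card S \<le> u" using U card_mono unfolding u_def by blast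
        then show "M * int (card S) - (m * edges_meeting u (card S) - 1) \<le> sum y S"
          using lm(1)[OF S] lowerA[of "card S"] by simp
        have "sum y S \<le> of_nat (card S) * M"
          by (rule sum_bounded_above) (use S U y in auto)
        then show "sum y S \<le> M * int (card S) - 0" by (simp add: mult.commute)
      qed
      moreover have "restrict y (V - U) \<in> ?B"
        unfolding restrict_mem_bounded_points_iff[OF Diff_subset]
      proof (intro allI impI conjI)
        fix S assume S: "S \<subseteq> V - U" "S \<noteq> {}"
        then have "card S \<le> n - u" using V card_mono[of "V - U" S] cVU by auto
        then show "sum y S \<le> (c - 1) * int (card S) + m * edges_meeting (n - u) (card S)"
          using lm(2)[OF S] upperB[of "card S"] un by simp
        show "0 \<le> sum y S" by (rule sum_nonneg) (use S y in auto)
      qed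
      ultimately show ?R using y by blast
    next
      assume R: ?R
      then have y: "y \<in> V \<rightarrow>\<^sub>E UNIV" by blast
      have A: "M * int (card S) - (m * edges_meeting u (card S) - 1) \<le> sum y S" "sum y S \<le> M * int (card S) - 0"
        if "S \<subseteq> U" "S \<noteq> {}" for S
        using R that unfolding restrict_mem_bounded_points_iff[OF U(1)] by auto
      have B: "0 \<le> sum y S" "sum y S \<le> (c - 1) * int (card S) + m * edges_meeting (n - u) (card S)"
        if "S \<subseteq> V - U" "S \<noteq> {}" for S
        using R that unfolding restrict_mem_bounded_points_iff[OF Diff_subset] by auto
      have "0 \<le> y i \<and> y i \<le> M" if i: "i \<in> V" for i
      proof (cases "i \<in> U")
        case True
        then have u1: "1 \<le> u" using U unfolding u_def by (metis One_nat_def Suc_leI card_gt_0_iff empty_iff)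
        have "m * (int u - 1) \<le> m * (int n - 1)" using m un by (intro mult_left_mono) auto
        then show ?thesis using A[of "{i}"] True c edges_meeting_1[OF u1] by (simp add: M_def)
      next
        case False
        with i have "V - U \<noteq> {}" by auto
        then have "1 \<le> n - u" using V cVU by (metis One_nat_def Suc_leI card_gt_0_iff finite_Diff)
        moreover have "m * (int (n - u) - 1) \<le> m * (int n - 1)" using m by (intro mult_left_mono) auto
        ultimately show ?thesis using B[of "{i}"] i False edges_meeting_1[of "n - u"] by (simp add: M_def)
      qed
      then have "y \<in> X" using y by (auto simp: X_def PiE_iff)
      moreover have "least_maximizer (\<lambda>S. sum y S + - f (card S)) V U"
        unfolding lmi
      proof (intro conjI allI impI)
        fix S assume S: "S \<subseteq> U" "S \<noteq> {}"
        then have "card S \<le> u" using U card_mono unfolding u_def by blast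
        then show "- f (u - card S) - - f u < sum y S"
          using A(1)[OF S] lowerA[of "card S"] by simp
      next
        fix S assume S: "S \<subseteq> V - U" "S \<noteq> {}"
        then have "card S \<le> n - u" using V card_mono[of "V - U" S] cVU by auto
        then show "sum y S \<le> - f u - - f (u + card S)"
          using B(2)[OF S] upperB[of "card S"] un by simp
      qed
      ultimately show ?L by blast
    qed
    have "card {y \<in> X. least_maximizer (\<lambda>S. sum y S + - f (card S)) V U} = card ?A * card ?B"
      unfolding eq by (rule card_restrict_product[OF U(1)]) (auto simp: bounded_points_def)
    also have "card ?A = interior_count m u"
      unfolding card_bounded_points_reflect card_bounded_points_eq_bounded_point_count[OF U(2)] interior_count_def u_def ..
    also have "card ?B = polymatroid_count m c (n - u)"
      using V by (simp add: card_bounded_points_eq_bounded_point_count cVU polymatroid_count_def)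
    finally show "card {y \<in> X. least_maximizer (\<lambda>S. sum y S + - f (card S)) V U} = interior_count m (card U) * polymatroid_count m c (n - card U)"
      unfolding u_def .
  qed
  also have "\<dots> = (\<Sum>k\<le>n. (n choose k) * (interior_count m k * polymatroid_count m c (n - k)))"
    using sum_Pow_card[OF V(1), of "\<lambda>k. interior_count m k * polymatroid_count m c (n - k)"] V(2) by simp
  finally have "(\<Sum>k\<le>n. (n choose k) * (interior_count m k * polymatroid_count m c (n - k))) = card X" by simp
  also have "card X = nat (M + 1) ^ n"
    unfolding X_def by (simp add: card_PiE V)
  also have "\<dots> = nat ((M + 1) ^ n)"
  proof (cases n)
    case (Suc k)
    then have "0 \<le> M" using m c by (simp add: M_def)
    then show ?thesis by (simp add: nat_power_eq)
  qed simp
  finally show ?thesis by (simp add: M_def mult.assoc)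
qed

text \<open>
  Now \<open>U\<close> is the set on which \<open>y\<close> falls most below the lower bounds \<open>m binom(|S|, 2)\<close>. Inside \<open>U\<close> the
  point satisfies the strict inequalities counted by \<open>interior_count\<close>; outside \<open>U\<close>, translation by
  \<open>m|U|\<close> in each coordinate makes it a point of the zonotope.
\<close>

lemma polymatroid_eq_interior_zonotope:
  assumes m: "m \<ge> 1" and c: "c \<ge> 1"
  shows "polymatroid_count m c n = (\<Sum>k\<le>n. (n choose k) * interior_count m k * zonotope_count m (c - 1) (n - k))"
proof -
  define V where "V = {..<n}"
  define g where "g s = m * int (s choose 2)" for s
  define X where "X = bounded_points (\<lambda>_. 0) (\<lambda>s. (c - 1) * int s + m * edges_meeting n s) V"
  let ?h = "\<lambda>y S. sum (\<lambda>i. - y i) S + g (card S)"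
  have V: "finite V" "card V = n" by (auto simp: V_def)
  have "card X = (\<Sum>U\<in>Pow V. card {y \<in> X. least_maximizer (?h y) V U})"
  proof (rule card_partition_by_least_maximizer[OF V(1)])
    show "finite X" unfolding X_def by (rule finite_bounded_points[OF V(1)])
  next
    fix y :: "nat \<Rightarrow> int" and A B assume AB: "A \<subseteq> V" "B \<subseteq> V"
    then have fin: "finite A" "finite B" using V finite_subset by blast+
    have "g (card A) + g (card B) \<le> g (card (A \<union> B)) + g (card (A \<inter> B))"
      unfolding g_def distrib_left[symmetric]
      using choose_two_supermodular[OF fin] m by (intro mult_left_mono) auto
    then show "?h y A + ?h y B \<le> ?h y (A \<union> B) + ?h y (A \<inter> B)"
      using sum_union_inter_int[OF fin, of "\<lambda>i. - y i"] by linarith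
  qed
  also have "\<dots> = (\<Sum>U\<in>Pow V. interior_count m (card U) * zonotope_count m (c - 1) (n - card U))"
  proof (rule sum.cong[OF refl])
    fix U assume "U \<in> Pow V"
    then have U: "U \<subseteq> V" "finite U" using V finite_subset by auto
    define u where "u = card U"
    have un: "u \<le> n" using U V card_mono unfolding u_def by blast
    have cVU: "card (V - U) = n - u" using U V by (simp add: card_Diff_subset u_def)
    let ?lo = "\<lambda>s. m * int (s choose 2) + (m * int u) * int s"
    let ?up = "\<lambda>s. (c - 1) * int s + m * edges_meeting (n - u) s + (m * int u) * int s"
    let ?A = "bounded_points (\<lambda>_. 0) (\<lambda>s. m * edges_meeting u s - 1) U"
    let ?B = "bounded_points ?lo ?up (V - U)"
    have upperA: "m * edges_meeting u s = g u - g (u - s)" if "s \<le> u" for s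
      unfolding edges_meeting_def g_def by (simp add: algebra_simps)
    have lowerB: "?lo s = g (u + s) - g u" for s
      unfolding g_def choose_two_add by (simp add: algebra_simps)
    have upperB: "?up s = (c - 1) * int s + m * edges_meeting n s" if "u + s \<le> n" for s
      unfolding edges_meeting_restrict[OF that] by (simp add: algebra_simps)
    have lmi: "least_maximizer (?h y) V U \<longleftrightarrow>
        (\<forall>S\<subseteq>U. S \<noteq> {} \<longrightarrow> sum y S < g u - g (u - card S)) \<and>
        (\<forall>S\<subseteq>V - U. S \<noteq> {} \<longrightarrow> g (u + card S) - g u \<le> sum y S)" for y
    proof -
      have flip: "a - b < - x \<longleftrightarrow> x < b - a" "- x \<le> a - b \<longleftrightarrow> b - a \<le> x" for a b x :: int
        by auto
      show ?thesis
        using least_maximizer_iff[OF V(1) U(1), of "\<lambda>i. - y i" g]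
        unfolding sum_negf u_def flip .
    qed
    have eq: "y \<in> X \<and> least_maximizer (?h y) V U \<longleftrightarrow>
        y \<in> V \<rightarrow>\<^sub>E UNIV \<and> restrict y U \<in> ?A \<and> restrict y (V - U) \<in> ?B" (is "?L \<longleftrightarrow> ?R") for y
    proof
      assume L: ?L
      then have y: "y \<in> V \<rightarrow>\<^sub>E UNIV" and yX: "y \<in> X" by (auto simp: X_def bounded_points_def)
      note bX = bounded_points_sum[OF yX[unfolded X_def]]
      have lm: "\<And>S. S \<subseteq> U \<Longrightarrow> S \<noteq> {} \<Longrightarrow> sum y S < g u - g (u - card S)"
        "\<And>S. S \<subseteq> V - U \<Longrightarrow> S \<noteq> {} \<Longrightarrow> sum y S \<ge> g (u + card S) - g u"
        using L unfolding lmi by (simp, simp)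
      have "restrict y U \<in> ?A"
        unfolding restrict_mem_bounded_points_iff[OF U(1)]
      proof (intro allI impI conjI)
        fix S assume S: "S \<subseteq> U" "S \<noteq> {}"
        then have "card S \<le> u" using U card_mono unfolding u_def by blast
        then show "sum y S \<le> m * edges_meeting u (card S) - 1"
          using lm(1)[OF S] upperA[of "card S"] by simp
        show "0 \<le> sum y S" using bX(1)[of S] S U by auto
      qed
      moreover have "restrict y (V - U) \<in> ?B"
        unfolding restrict_mem_bounded_points_iff[OF Diff_subset]
      proof (intro allI impI conjI)
        fix S assume S: "S \<subseteq> V - U" "S \<noteq> {}"
        then have "card S \<le> n - u" using V card_mono[of "V - U" S] cVU by auto
        then have "u + card S \<le> n" using un by simp
        then show "sum y S \<le> ?up (card S)"
          unfolding upperB[OF \<open>u + card S \<le> n\<close>] using bX(2)[of S] S by auto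
        show "?lo (card S) \<le> sum y S" unfolding lowerB using lm(2)[OF S] .
      qed
      ultimately show ?R using y by blast
    next
      assume R: ?R
      then have y: "y \<in> V \<rightarrow>\<^sub>E UNIV" by blast
      have A: "0 \<le> sum y S" "sum y S \<le> m * edges_meeting u (card S) - 1" if "S \<subseteq> U" "S \<noteq> {}" for S
        using R that unfolding restrict_mem_bounded_points_iff[OF U(1)] by auto
      have B: "?lo (card S) \<le> sum y S" "sum y S \<le> ?up (card S)" if "S \<subseteq> V - U" "S \<noteq> {}" for S
        using R that unfolding restrict_mem_bounded_points_iff[OF Diff_subset] by auto
      have "0 \<le> sum y S \<and> sum y S \<le> (c - 1) * int (card S) + m * edges_meeting n (card S)"
        if S: "S \<subseteq> V" for S
      proof -
        define S1 S2 where "S1 = S \<inter> U" and "S2 = S - U"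
        have sub: "S1 \<subseteq> U" "S2 \<subseteq> V - U" "S = S1 \<union> S2" "S1 \<inter> S2 = {}" using S by (auto simp: S1_def S2_def)
        then have fin: "finite S1" "finite S2" using U V finite_subset[of S2 V] finite_subset by auto
        have card: "card S = card S1 + card S2" and sum: "sum y S = sum y S1 + sum y S2"
          using sub fin by (auto simp: card_Un_disjoint sum.union_disjoint)
        have c1: "card S1 \<le> u" using sub U card_mono unfolding u_def by blast
        have c2: "u + card S2 \<le> n" using card_mono[of "V - U" S2] cVU V sub un by auto
        have 1: "0 \<le> sum y S1" "sum y S1 \<le> m * edges_meeting u (card S1)"
          using A[OF sub(1)] by (cases "S1 = {}"; force)+
        have lo0: "0 \<le> ?lo (card S2)" using m by simp
        have 2: "0 \<le> sum y S2" "sum y S2 \<le> (c - 1) * int (card S2) + m * edges_meeting n (card S2)"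
          unfolding upperB[OF c2, symmetric] using B[OF sub(2)] lo0 by (cases "S2 = {}"; force)+
        have "m * (edges_meeting u (card S1) + edges_meeting n (card S2)) \<le> m * edges_meeting n (card S)"
          unfolding card using edges_meeting_split[OF c1 c2] m by (intro mult_left_mono) auto
        moreover have "(c - 1) * int (card S2) \<le> (c - 1) * int (card S)"
          unfolding card using c by (intro mult_left_mono) auto
        ultimately show ?thesis using 1 2 sum by (simp add: distrib_left)
      qed
      then have "y \<in> X" using y by (auto simp: X_def bounded_points_def)
      moreover have "least_maximizer (?h y) V U"
        unfolding lmi
      proof (intro conjI allI impI)
        fix S assume S: "S \<subseteq> U" "S \<noteq> {}"
        then have "card S \<le> u" using U card_mono unfolding u_def by blast
        then show "sum y S < g u - g (u - card S)"
          using A(2)[OF S] upperA[of "card S"] by simp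
      next
        fix S assume S: "S \<subseteq> V - U" "S \<noteq> {}"
        from B(1)[OF this] show "g (u + card S) - g u \<le> sum y S"
          unfolding lowerB .
      qed
      ultimately show ?L by blast
    qed
    have "card {y \<in> X. least_maximizer (?h y) V U} = card ?A * card ?B"
      unfolding eq by (rule card_restrict_product[OF U(1)]) (auto simp: bounded_points_def)
    also have "card ?A = interior_count m u"
      unfolding card_bounded_points_eq_bounded_point_count[OF U(2)] interior_count_def u_def ..
    also have "card ?B = zonotope_count m (c - 1) (n - u)"
      using V by (simp add: card_bounded_points_translate card_bounded_points_eq_bounded_point_count cVU zonotope_count_def)
    finally show "card {y \<in> X. least_maximizer (?h y) V U} = interior_count m (card U) * zonotope_count m (c - 1) (n - card U)"
      unfolding u_def .
  qed
  also have "\<dots> = (\<Sum>k\<le>n. (n choose k) * (interior_count m k * zonotope_count m (c - 1) (n - k)))"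
    using sum_Pow_card[OF V(1), of "\<lambda>k. interior_count m k * zonotope_count m (c - 1) (n - k)"] V(2) by simp
  also have "card X = polymatroid_count m c n"
    by (simp add: X_def polymatroid_count_def bounded_point_count_def V_def)
  finally show ?thesis by (simp add: mult.assoc)
qed

text \<open>
  For \<open>l = 0\<close> the lower and the upper bound agree on the whole vertex set, so the last coordinate is
  determined by the others. The bounds on a set that contains it are equivalent to the opposite
  bounds on the complement; what remains on \<open>n\<close> vertices are the \<open>m\<close> former edges from each vertex to the
  dropped one, which have become \<open>m\<close> loops.
\<close>

lemma zonotope_count_Suc: "zonotope_count m 0 (Suc n) = zonotope_count m m n"
proof -
  let ?lo = "\<lambda>s. m * int (s choose 2)"
  let ?up = "\<lambda>s. 0 * int s + m * edges_meeting (Suc n) s"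
  let ?up' = "\<lambda>s. m * int s + m * edges_meeting n s"
  let ?V = "{..<n}" and ?W = "{..<Suc n}"
  let ?P = "bounded_points ?lo ?up ?W" and ?Q = "bounded_points ?lo ?up' ?V"
  let ?t = "m * int (Suc n choose 2)"
  let ?ext = "\<lambda>y. \<lambda>i\<in>?W. if i = n then ?t - sum y ?V else y i"
  have up_eq: "?up s = ?up' s" if "s \<le> n" for s
  proof -
    have "edges_meeting (Suc n) s = edges_meeting n s + int s"
      by (rule int_eq_by_doubling) (use that twice_edges_meeting[of s n] twice_edges_meeting[of s "Suc n"] in \<open>simp add: algebra_simps\<close>)
    then show ?thesis by (simp add: algebra_simps)
  qed
  have compl: "?up s = ?t - ?lo (Suc n - s)" for s
    by (simp add: edges_meeting_def algebra_simps)
  have total: "sum y ?V + y n = ?t" if "y \<in> ?P" for y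
  proof -
    have "?lo (card ?W) \<le> sum y ?W" "sum y ?W \<le> ?up (card ?W)"
      using bounded_points_sum[OF that, of ?W] by auto
    then show ?thesis by (simp add: edges_meeting_def numeral_2_eq_2)
  qed
  have "bij_betw (\<lambda>y. restrict y ?V) ?P ?Q"
  proof (rule bij_betw_byWitness[where f' = ?ext])
    show "\<forall>y\<in>?P. ?ext (restrict y ?V) = y"
    proof
      fix y assume y: "y \<in> ?P"
      then have "y \<in> ?W \<rightarrow>\<^sub>E UNIV" by (simp add: bounded_points_def)
      then show "?ext (restrict y ?V) = y"
        using total[OF y] by (auto simp: fun_eq_iff extensional_def PiE_iff)
    qed
    show "\<forall>y\<in>?Q. restrict (?ext y) ?V = y"
      by (auto simp: bounded_points_def fun_eq_iff extensional_def PiE_iff)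
    show "(\<lambda>y. restrict y ?V) ` ?P \<subseteq> ?Q"
    proof (rule image_subsetI)
      fix y assume y: "y \<in> ?P"
      show "restrict y ?V \<in> ?Q"
        unfolding restrict_mem_bounded_points_iff[OF order_refl]
      proof (intro allI impI)
        fix S assume S: "S \<subseteq> ?V" "S \<noteq> {}"
        then have "card S \<le> n" using card_mono[of ?V S] by simp
        with S bounded_points_sum[OF y, of S] show "?lo (card S) \<le> sum y S \<and> sum y S \<le> ?up' (card S)"
          using up_eq[of "card S"] by (auto simp: subset_eq less_Suc_eq)
      qed
    qed
    show "?ext ` ?Q \<subseteq> ?P"
    proof (rule image_subsetI)
      fix y assume y: "y \<in> ?Q"
      have bnd: "?lo (card S) \<le> sum y S \<and> sum y S \<le> ?up (card S)" if S: "S \<subseteq> ?V" for S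
      proof (cases "S = {}")
        case False
        have "card S \<le> n" using S card_mono[of ?V S] by simp
        then show ?thesis using bounded_points_sum[OF y S False] up_eq[of "card S"] by simp
      qed (simp add: numeral_2_eq_2)
      have "?lo (card S) \<le> sum (?ext y) S \<and> sum (?ext y) S \<le> ?up (card S)" if S: "S \<subseteq> ?W" for S
      proof (cases "n \<in> S")
        case False
        then have "S \<subseteq> ?V" using S by (auto simp: subset_eq less_Suc_eq)
        moreover have "sum (?ext y) S = sum y S" using S False by (intro sum.cong) auto
        ultimately show ?thesis using bnd by simp
      next
        case True
        define R where "R = S - {n}"
        have R: "R \<subseteq> ?V" "S = insert n R" "n \<notin> R" "finite R"
          using S True by (auto simp: R_def subset_eq less_Suc_eq intro: finite_subset[of _ ?W])
        have cS: "card S = Suc (card R)" using R by simp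
        have "sum (?ext y) R = sum y R" using R by (intro sum.cong) auto
        then have "sum (?ext y) S = ?t - sum y ?V + sum y R"
          using R by simp
        also have "sum y R = sum y ?V - sum y (?V - R)"
          using sum_diff[of ?V R y] R by simp
        finally have e: "sum (?ext y) S = ?t - sum y (?V - R)" by simp
        have cc: "card (?V - R) = n - card R" using R by (simp add: card_Diff_subset)
        have cR: "card R \<le> n" using R card_mono[of ?V R] by simp
        then have "Suc n - (n - card R) = card S" "n - card R = Suc n - card S" using cS by auto
        then show ?thesis
          using bnd[of "?V - R"] unfolding e cc compl by auto
      qed
      then show "?ext y \<in> ?P" by (auto simp: bounded_points_def)
    qed
  qed
  then have "card ?P = card ?Q" by (rule bij_betw_same_card)
  then show ?thesis by (simp add: zonotope_count_def bounded_point_count_def)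
qed

section \<open>The closed form of the polymatroid count\<close>

lemma bounded_point_count_0: "bounded_point_count lo up 0 = 1"
  by (simp add: bounded_point_count_def bounded_points_def)

lemma real_nat_power:
  assumes "m \<ge> 1" "c \<ge> 1"
  shows "real (nat ((c + m * (int n - 1)) ^ n)) = (of_int c - of_int m + of_int m * real n) ^ n"
proof (cases n)
  case (Suc k)
  then have "0 \<le> c + m * (int n - 1)" using assms by simp
  then have "real (nat ((c + m * (int n - 1)) ^ n)) = of_int (c + m * (int n - 1)) ^ n" by simp
  also have "of_int (c + m * (int n - 1)) = (of_int c - of_int m + of_int m * real n :: real)"
    by (simp add: algebra_simps)
  finally show ?thesis .
qed simp

text \<open>
  The generating function of the interior counts is eliminated by means of the values \<open>1\<close> and \<open>m + 1\<close> of
  the parameter \<open>c\<close>.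
\<close>

lemma polymatroid_count_explicit:
  assumes m: "m \<ge> 1" and c: "c \<ge> 1"
  shows "real (polymatroid_count m c n) =
    explicit_count n (of_int m) (2 * of_int c - of_int m + 2 * of_int m * real n)"
proof -
  let ?N = "\<lambda>c. egf (\<lambda>n. real (polymatroid_count m c n))"
  let ?Z = "\<lambda>l. egf (\<lambda>n. real (zonotope_count m l n))"
  let ?I = "egf (\<lambda>n. real (interior_count m n))"
  have IN: "?I * ?N c = egf (\<lambda>n. (of_int c - of_int m + of_int m * real n) ^ n)" if "c \<ge> 1" for c
    unfolding egf_mult
  proof (rule arg_cong[where f = egf], rule ext)
    fix n
    show "(\<Sum>k\<le>n. real (n choose k) * real (interior_count m k) * real (polymatroid_count m c (n - k))) =
        (of_int c - of_int m + of_int m * real n) ^ n"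
      using arg_cong[OF polymatroid_interior_convolution[OF m that, of n], of real]
      unfolding real_nat_power[OF m that] by simp
  qed
  have IZ: "?I * ?Z (c - 1) = ?N c" if "c \<ge> 1" for c
    unfolding egf_mult polymatroid_eq_interior_zonotope[OF m that] by simp
  have Z': "fps_deriv (?Z 0) = ?Z m"
    unfolding fps_deriv_egf zonotope_count_Suc ..
  have "?N c = ehrhart_gf (of_int m) (of_int c / of_int m - 1 / 2)"
  proof (rule egf_eq_ehrhart_gf)
    show "?I ^ 2 * ?Z 0 = egf (\<lambda>n. (1 - of_int m + of_int m * real n) ^ n)"
      using IN[of 1] IZ[of 1] by (simp add: power2_eq_square mult.assoc)
    show "?I ^ 2 * fps_deriv (?Z 0) = egf (\<lambda>n. (1 + of_int m * real n) ^ n)"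
      unfolding Z' using IN[of "m + 1"] IZ[of "m + 1"] m by (simp add: power2_eq_square mult.assoc)
  qed (use m IN[OF c] in \<open>simp_all add: interior_count_def zonotope_count_def polymatroid_count_def bounded_point_count_0\<close>)
  also have "\<dots> = egf (\<lambda>n. explicit_count n (of_int m) (2 * of_int m * (of_int c / of_int m - 1 / 2 + real n)))"
    by (rule ehrhart_gf_eq_egf) (use m in simp)
  finally have "?N c $ n = \<dots> $ n" by simp
  then have "real (polymatroid_count m c n) = explicit_count n (of_int m) (2 * of_int m * (of_int c / of_int m - 1 / 2 + real n))"
    by simp
  also have "2 * of_int m * (of_int c / of_int m - 1 / 2 + real n) = 2 * of_int c - of_int m + 2 * of_int m * real n"
    using m by (simp add: field_simps)
  finally show ?thesis .
qed

section \<open>Symmetric polymatroids as convex hulls\<close>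

abbreviation coord :: "(nat \<Rightarrow>\<^sub>0 real) \<Rightarrow> nat \<Rightarrow> real" where
  "coord \<equiv> Poly_Mapping.lookup"

lemma coord_scaleR [simp]: "coord (c *\<^sub>R x) i = c * coord x i"
  by (simp add: scaleR_poly_mapping_def Poly_Mapping.map.rep_eq when_def)

definition vec_on :: "(nat \<Rightarrow> real) \<Rightarrow> nat set \<Rightarrow> (nat \<Rightarrow>\<^sub>0 real)" where
  "vec_on f V = (\<Sum>i\<in>V. Poly_Mapping.single i (f i))"

lemma coord_vec_on: "finite V \<Longrightarrow> coord (vec_on f V) j = (if j \<in> V then f j else 0)"
  by (simp add: vec_on_def lookup_sum lookup_single when_def)

text \<open>
  The polymatroid on \<open>V\<close> whose rank function has the increments \<open>u 0, u 1, \<dots>\<close>.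
\<close>

definition feasible :: "(nat \<Rightarrow> real) \<Rightarrow> nat set \<Rightarrow> (nat \<Rightarrow>\<^sub>0 real) \<Rightarrow> bool" where
  "feasible u V y \<longleftrightarrow> (\<forall>i. i \<notin> V \<longrightarrow> coord y i = 0) \<and> (\<forall>i\<in>V. 0 \<le> coord y i) \<and>
     (\<forall>S\<subseteq>V. sum (coord y) S \<le> (\<Sum>l<card S. u l))"

text \<open>
  The greedy algorithm assigns the increments to the coordinates in some order and may stop early,
  which leaves zeros. Here zeros are allowed in any positions; the additional points lie in the
  polymatroid as well when \<open>u\<close> is nonincreasing and nonnegative, and they make the set easy to
  recognise.
\<close>

definition greedy_vertices :: "(nat \<Rightarrow> real) \<Rightarrow> nat set \<Rightarrow> (nat \<Rightarrow>\<^sub>0 real) set" where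
  "greedy_vertices u V = {v. (\<forall>i. i \<notin> V \<longrightarrow> coord v i = 0) \<and>
     (\<exists>\<sigma>. bij_betw \<sigma> V {..<card V} \<and> (\<forall>i\<in>V. coord v i = 0 \<or> coord v i = u (\<sigma> i)))}"

lemma convex_segment:
  assumes "convex C" "p + \<alpha> *\<^sub>R d \<in> C" "p - \<beta> *\<^sub>R d \<in> C" "\<alpha> \<ge> 0" "\<beta> \<ge> (0::real)"
  shows "p \<in> C"
proof (cases "\<alpha> + \<beta> = 0")
  case True
  then have "\<alpha> = 0" using assms by simp
  then show ?thesis using assms by simp
next
  case False
  then have pos: "\<alpha> + \<beta> > 0" using assms by simp
  have "(\<beta> / (\<alpha> + \<beta>)) *\<^sub>R (p + \<alpha> *\<^sub>R d) + (\<alpha> / (\<alpha> + \<beta>)) *\<^sub>R (p - \<beta> *\<^sub>R d) =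
      (\<beta> / (\<alpha> + \<beta>) + \<alpha> / (\<alpha> + \<beta>)) *\<^sub>R p"
    by (simp add: algebra_simps)
  also have "\<beta> / (\<alpha> + \<beta>) + \<alpha> / (\<alpha> + \<beta>) = 1"
    using pos by (simp add: add_divide_distrib[symmetric] add.commute)
  finally have "p = (\<beta> / (\<alpha> + \<beta>)) *\<^sub>R (p + \<alpha> *\<^sub>R d) + (\<alpha> / (\<alpha> + \<beta>)) *\<^sub>R (p - \<beta> *\<^sub>R d)" by simp
  also have "\<dots> \<in> C"
    by (rule convexD[OF assms(1-3)])
       (use assms pos in \<open>simp_all add: add_divide_distrib[symmetric] add.commute\<close>)
  finally show ?thesis .
qed

lemma greedy_vertices_mono:
  assumes "finite V" "i \<in> V"
  shows "greedy_vertices u (V - {i}) \<subseteq> greedy_vertices u V"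
proof
  fix v assume "v \<in> greedy_vertices u (V - {i})"
  then obtain \<sigma> where v: "\<And>j. j \<notin> V - {i} \<Longrightarrow> coord v j = 0"
    and \<sigma>: "bij_betw \<sigma> (V - {i}) {..<card (V - {i})}"
    and val: "\<And>j. j \<in> V - {i} \<Longrightarrow> coord v j = 0 \<or> coord v j = u (\<sigma> j)"
    by (auto simp: greedy_vertices_def)
  define n where "n = card (V - {i})"
  have cV: "card V = Suc n" unfolding n_def by (rule card_Suc_Diff1[OF assms, symmetric])
  have "bij_betw (\<sigma>(i := n)) (V - {i}) {..<n}"
    using \<sigma> unfolding n_def by (subst bij_betw_cong[of _ _ \<sigma>]) auto
  then have "bij_betw (\<sigma>(i := n)) (V - {i} \<union> {i}) ({..<n} \<union> {n})"
    by (rule bij_betw_combine) auto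
  moreover have "V - {i} \<union> {i} = V" "{..<n} \<union> {n} = {..<Suc n}" using assms by auto
  ultimately have "bij_betw (\<sigma>(i := n)) V {..<card V}" unfolding cV by simp
  moreover have "coord v j = 0 \<or> coord v j = u ((\<sigma>(i := n)) j)" if "j \<in> V" for j
    using v[of j] val[of j] that by auto
  moreover have "coord v j = 0" if "j \<notin> V" for j using v that by auto
  ultimately show "v \<in> greedy_vertices u V" unfolding greedy_vertices_def by blast
qed

lemma greedy_vertices_sum:
  assumes "finite V" "S \<subseteq> V" "v \<in> greedy_vertices u S" "w \<in> greedy_vertices (\<lambda>l. u (card S + l)) (V - S)"
  shows "v + w \<in> greedy_vertices u V"
proof -
  define s where "s = card S"
  obtain \<sigma> where v: "\<And>j. j \<notin> S \<Longrightarrow> coord v j = 0"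
    and \<sigma>: "bij_betw \<sigma> S {..<s}" "\<And>j. j \<in> S \<Longrightarrow> coord v j = 0 \<or> coord v j = u (\<sigma> j)"
    using assms(3) by (auto simp: greedy_vertices_def s_def)
  obtain \<tau> where w: "\<And>j. j \<notin> V - S \<Longrightarrow> coord w j = 0"
    and \<tau>: "bij_betw \<tau> (V - S) {..<card (V - S)}" "\<And>j. j \<in> V - S \<Longrightarrow> coord w j = 0 \<or> coord w j = u (s + \<tau> j)"
    using assms(4) by (auto simp: greedy_vertices_def s_def)
  have fS: "finite S" using assms finite_subset by blast
  have cV: "card V = s + card (V - S)"
    using assms fS card_mono[OF assms(1,2)] by (simp add: s_def card_Diff_subset)
  let ?\<rho> = "\<lambda>j. if j \<in> S then \<sigma> j else s + \<tau> j"
  have 1: "bij_betw ?\<rho> S {..<s}" using \<sigma>(1) by (subst bij_betw_cong[of _ _ \<sigma>]) auto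
  have "bij_betw (\<lambda>k. s + k) {..<card (V - S)} {s..<card V}"
    unfolding cV by (rule bij_betw_byWitness[where f' = "\<lambda>k. k - s"]) auto
  from bij_betw_trans[OF \<tau>(1) this] have "bij_betw (\<lambda>j. s + \<tau> j) (V - S) {s..<card V}"
    by (simp add: comp_def)
  then have 2: "bij_betw ?\<rho> (V - S) {s..<card V}" by (subst bij_betw_cong[of _ _ "\<lambda>j. s + \<tau> j"]) auto
  have "bij_betw ?\<rho> (S \<union> (V - S)) ({..<s} \<union> {s..<card V})"
    by (rule bij_betw_combine[OF 1 2]) auto
  moreover have "S \<union> (V - S) = V" "{..<s} \<union> {s..<card V} = {..<card V}" using assms(2) cV by auto
  ultimately have "bij_betw ?\<rho> V {..<card V}" by simp
  moreover have "coord (v + w) j = 0 \<or> coord (v + w) j = u (?\<rho> j)" if "j \<in> V" for j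
    using v[of j] w[of j] \<sigma>(2)[of j] \<tau>(2)[of j] that by (auto simp: lookup_add)
  moreover have "coord (v + w) j = 0" if "j \<notin> V" for j
    using v[of j] w[of j] that assms(2) by (auto simp: lookup_add)
  ultimately show ?thesis unfolding greedy_vertices_def by blast
qed

text \<open>
  A tight set \<open>S\<close> splits the polymatroid at \<open>y\<close> into its restriction to \<open>S\<close> and its contraction, whose
  increments are those of \<open>u\<close> from position \<open>|S|\<close> on.
\<close>

lemma feasible_split:
  assumes "finite V" "feasible u V y" "S \<subseteq> V" "sum (coord y) S = (\<Sum>l<card S. u l)"
  shows "feasible u S (vec_on (coord y) S)"
    and "feasible (\<lambda>l. u (card S + l)) (V - S) (vec_on (coord y) (V - S))"
    and "y = vec_on (coord y) S + vec_on (coord y) (V - S)"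
proof -
  have fin: "finite S" using assms finite_subset by blast
  have sums: "sum (coord (vec_on (coord y) W)) R = sum (coord y) R" if "R \<subseteq> W" "finite W" for R W
    using that by (intro sum.cong) (auto simp: coord_vec_on)
  show "feasible u S (vec_on (coord y) S)"
    using assms fin sums[of _ S] by (auto simp: feasible_def coord_vec_on)
  have "sum (coord y) R \<le> (\<Sum>l<card R. u (card S + l))" if R: "R \<subseteq> V - S" for R
  proof -
    have fR: "finite R" "S \<inter> R = {}" "S \<union> R \<subseteq> V" using R assms(1,3) finite_subset[of R V] by auto
    have shift: "(\<Sum>l<a + b. u l) = (\<Sum>l<a. u l) + (\<Sum>l<b. u (a + l))" for a b
      by (induction b) simp_all
    have "sum (coord y) S + sum (coord y) R = sum (coord y) (S \<union> R)"
      using fin fR by (simp add: sum.union_disjoint)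
    also have "\<dots> \<le> (\<Sum>l<card (S \<union> R). u l)"
      using assms(2) fR by (simp add: feasible_def)
    also have "(\<Sum>l<card (S \<union> R). u l) = (\<Sum>l<card S + card R. u l)"
      using fin fR by (simp add: card_Un_disjoint)
    also have "\<dots> = (\<Sum>l<card S. u l) + (\<Sum>l<card R. u (card S + l))"
      by (rule shift)
    finally show ?thesis using assms(4) by simp
  qed
  then show "feasible (\<lambda>l. u (card S + l)) (V - S) (vec_on (coord y) (V - S))"
    using assms sums[of _ "V - S"] by (auto simp: feasible_def coord_vec_on)
  show "y = vec_on (coord y) S + vec_on (coord y) (V - S)"
    using assms fin by (intro poly_mapping_eqI) (auto simp: lookup_add coord_vec_on feasible_def)
qed

lemma sum_add_scaleR_coord:
  "sum (coord (y + \<alpha> *\<^sub>R d)) S = sum (coord y) S + \<alpha> * sum (coord d) S"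
  by (simp add: lookup_add sum.distrib sum_distrib_left)

lemma sum_coord_single:
  assumes "finite S"
  shows "sum (coord (Poly_Mapping.single i 1)) S = (if i \<in> S then 1 else 0)"
  using assms by (simp add: lookup_single when_def)

text \<open>
  Induction on the dimension. A point with a zero coordinate, or with a tight nonempty proper set
  \<open>S\<close>, is reduced to smaller dimensions. If the whole of \<open>V\<close> is tight, moving along \<open>e\<^sub>i - e\<^sub>j\<close> in either
  direction reaches a tight proper set before the shrinking coordinate becomes negative, so the point
  lies on a segment between two points already treated. In general, moving along \<open>e\<^sub>i\<close> upwards reaches
  some tight set, and moving downwards reaches a zero coordinate.
\<close>

lemma feasible_in_hull:
  assumes "finite V" "feasible u V y" "\<And>k l. k \<le> l \<Longrightarrow> u l \<le> u k" "\<And>l. 0 \<le> u l"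
  shows "y \<in> convex hull (greedy_vertices u V)"
  using assms
proof (induction "card V" arbitrary: V u y rule: less_induct)
  case less
  define H where "H = convex hull (greedy_vertices u V)"
  define G where "G s = (\<Sum>l<s. u l)" for s
  note fin = less.prems(1)
  have convH: "convex H" by (simp add: H_def)
  have finS: "finite S" if "S \<subseteq> V" for S using fin that finite_subset by blast
  have feasD: "\<And>i. i \<notin> V \<Longrightarrow> coord y i = 0" "\<And>i. i \<in> V \<Longrightarrow> 0 \<le> coord y i"
    "\<And>S. S \<subseteq> V \<Longrightarrow> sum (coord y) S \<le> G (card S)" if "feasible u V y" for y
    using that by (auto simp: feasible_def G_def)
  have zero_case: "y \<in> H" if y: "feasible u V y" and i: "i \<in> V" "coord y i = 0" for y i
  proof -
    have "card (V - {i}) < card V" using fin i(1) by (rule card_Diff1_less)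
    moreover have "feasible u (V - {i}) y" using y i by (auto simp: feasible_def)
    ultimately have "y \<in> convex hull (greedy_vertices u (V - {i}))"
      using less.hyps[of "V - {i}" u y] fin less.prems(3,4) by blast
    then show ?thesis unfolding H_def
      using hull_mono[OF greedy_vertices_mono[OF fin i(1)]] by blast
  qed
  have tight_case: "y \<in> H" if y: "feasible u V y" and S: "S \<subset> V" "S \<noteq> {}" "sum (coord y) S = G (card S)" for y S
  proof -
    have "S \<subseteq> V" using S by auto
    note split = feasible_split[OF fin y \<open>S \<subseteq> V\<close> S(3)[unfolded G_def]]
    have "card S < card V" using S fin by (simp add: psubset_card_mono)
    then have 1: "vec_on (coord y) S \<in> convex hull (greedy_vertices u S)"
      using less.hyps[of S u] finS[OF \<open>S \<subseteq> V\<close>] split(1) less.prems(3,4) by blast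
    have "card (V - S) < card V" using S fin by (intro psubset_card_mono) auto
    then have 2: "vec_on (coord y) (V - S) \<in> convex hull (greedy_vertices (\<lambda>l. u (card S + l)) (V - S))"
      by (rule less.hyps) (use fin split(2) less.prems(3,4) in auto)
    have "y \<in> convex hull (greedy_vertices u S + greedy_vertices (\<lambda>l. u (card S + l)) (V - S))"
      unfolding convex_hull_set_plus by (subst split(3)) (rule set_plus_intro[OF 1 2])
    moreover have "greedy_vertices u S + greedy_vertices (\<lambda>l. u (card S + l)) (V - S) \<subseteq> greedy_vertices u V"
      using greedy_vertices_sum[OF fin \<open>S \<subseteq> V\<close>] by (auto elim!: set_plus_elim)
    ultimately show ?thesis unfolding H_def using hull_mono by blast
  qed
  have full_move: "\<exists>\<alpha>\<ge>0. y + \<alpha> *\<^sub>R (Poly_Mapping.single i 1 - Poly_Mapping.single j 1) \<in> H"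
    if y: "feasible u V y" and full: "sum (coord y) V = G (card V)" and ij: "i \<in> V" "j \<in> V" "i \<noteq> j" for y i j
  proof -
    let ?F = "{S. S \<subseteq> V \<and> i \<in> S \<and> j \<notin> S}"
    let ?slack = "\<lambda>S. G (card S) - sum (coord y) S"
    let ?d = "Poly_Mapping.single i 1 - Poly_Mapping.single j (1::real)"
    \<comment> \<open>The longest step along \<open>?d\<close> that violates no upper bound.\<close>
    define \<alpha> where "\<alpha> = Min (?slack ` ?F)"
    have F: "finite (?slack ` ?F)" "?slack ` ?F \<noteq> {}" using fin ij by auto
    obtain S where S: "S \<in> ?F" "\<alpha> = ?slack S" using Min_in[OF F] unfolding \<alpha>_def by auto
    have le: "\<alpha> \<le> ?slack W" if "W \<in> ?F" for W unfolding \<alpha>_def using F that by (intro Min_le) auto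
    have "\<alpha> \<ge> 0" using S feasD(3)[OF y, of S] by simp
    have d: "sum (coord ?d) W = (if i \<in> W then 1 else 0) - (if j \<in> W then 1 else 0)" if "W \<subseteq> V" for W
      using finS[OF that] sum_coord_single[of W i] sum_coord_single[of W j] by (simp add: lookup_minus sum_subtractf)
    \<comment> \<open>The set \<open>V - {j}\<close> limits the step, because \<open>V\<close> is tight and the rank function is monotone.\<close>
    have "\<alpha> \<le> coord y j"
    proof -
      have "card V = Suc (card (V - {j}))" by (rule card_Suc_Diff1[OF fin ij(2), symmetric])
      then have "G (card (V - {j})) \<le> G (card V)" using less.prems(4) by (simp add: G_def)
      moreover have "\<alpha> \<le> ?slack (V - {j})" using ij by (intro le) auto
      moreover have "sum (coord y) (V - {j}) = sum (coord y) V - coord y j" using fin ij by (simp add: sum_diff1)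
      ultimately show ?thesis using full by linarith
    qed
    have moved: "feasible u V (y + \<alpha> *\<^sub>R ?d)"
      unfolding feasible_def G_def[symmetric]
    proof (intro conjI allI impI ballI)
      fix k assume "k \<notin> V"
      then show "coord (y + \<alpha> *\<^sub>R ?d) k = 0"
        using feasD(1)[OF y] ij by (auto simp: lookup_add lookup_minus lookup_single when_def)
    next
      fix k assume "k \<in> V"
      then show "0 \<le> coord (y + \<alpha> *\<^sub>R ?d) k"
        using feasD(2)[OF y] ij \<open>\<alpha> \<ge> 0\<close> \<open>\<alpha> \<le> coord y j\<close> by (auto simp: lookup_add lookup_minus lookup_single when_def)
    next
      fix W assume W: "W \<subseteq> V"
      show "sum (coord (y + \<alpha> *\<^sub>R ?d)) W \<le> G (card W)"
        unfolding sum_add_scaleR_coord d[OF W]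
        using feasD(3)[OF y W] le[of W] W \<open>\<alpha> \<ge> 0\<close> by auto
    qed
    have tight: "sum (coord (y + \<alpha> *\<^sub>R ?d)) S = G (card S)"
      using S unfolding sum_add_scaleR_coord by (simp add: d)
    have "S \<subset> V" "S \<noteq> {}" using S ij by auto
    from tight_case[OF moved this tight] have "y + \<alpha> *\<^sub>R ?d \<in> H" .
    with \<open>\<alpha> \<ge> 0\<close> show ?thesis by blast
  qed
  have full_case: "y \<in> H" if y: "feasible u V y" and full: "sum (coord y) V = G (card V)" and "V \<noteq> {}" for y
  proof (cases "\<exists>i j. i \<in> V \<and> j \<in> V \<and> i \<noteq> j")
    case True
    then obtain i j where ij: "i \<in> V" "j \<in> V" "i \<noteq> j" by blast
    let ?d = "Poly_Mapping.single i 1 - Poly_Mapping.single j (1::real)"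
    obtain \<alpha> where \<alpha>: "\<alpha> \<ge> 0" "y + \<alpha> *\<^sub>R ?d \<in> H" using full_move[OF y full ij] by blast
    obtain \<beta> where \<beta>: "\<beta> \<ge> 0" "y + \<beta> *\<^sub>R (Poly_Mapping.single j 1 - Poly_Mapping.single i 1) \<in> H"
      using full_move[OF y full ij(2,1)] ij(3) by blast
    have "y + \<beta> *\<^sub>R (Poly_Mapping.single j 1 - Poly_Mapping.single i 1) = y - \<beta> *\<^sub>R ?d"
      by (simp add: algebra_simps)
    with \<beta> have "y - \<beta> *\<^sub>R ?d \<in> H" by simp
    from convex_segment[OF convH \<alpha>(2) this \<alpha>(1) \<beta>(1)] show ?thesis .
  next
    case False
    with \<open>V \<noteq> {}\<close> obtain i where V: "V = {i}" by blast
    have "coord y i = u 0" using full by (simp add: V G_def)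
    then have "y \<in> greedy_vertices u V"
      using feasD(1)[OF y] unfolding greedy_vertices_def V
      by (auto intro!: exI[of _ "\<lambda>_. 0"] simp: bij_betw_def)
    then show ?thesis unfolding H_def by (rule hull_inc)
  qed
  show ?case
  proof (cases "V = {}")
    case True
    then have "y \<in> greedy_vertices u V"
      using feasD(1)[OF less.prems(2)] by (auto simp: greedy_vertices_def bij_betw_def)
    then show ?thesis by (rule hull_inc)
  next
    case False
    then obtain i where i: "i \<in> V" by blast
    note y = less.prems(2)
    let ?F = "{S. S \<subseteq> V \<and> i \<in> S}"
    let ?slack = "\<lambda>S. G (card S) - sum (coord y) S"
    let ?d = "Poly_Mapping.single i (1::real)"
    define \<alpha> where "\<alpha> = Min (?slack ` ?F)"
    have F: "finite (?slack ` ?F)" "?slack ` ?F \<noteq> {}" using fin i by auto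
    obtain S where S: "S \<in> ?F" "\<alpha> = ?slack S" using Min_in[OF F] unfolding \<alpha>_def by auto
    have le: "\<alpha> \<le> ?slack W" if "W \<in> ?F" for W unfolding \<alpha>_def using F that by (intro Min_le) auto
    have "\<alpha> \<ge> 0" using S feasD(3)[OF y, of S] by simp
    have d: "sum (coord ?d) W = (if i \<in> W then 1 else 0)" if "W \<subseteq> V" for W
      using finS[OF that] by (rule sum_coord_single)
    have up: "feasible u V (y + \<alpha> *\<^sub>R ?d)"
      unfolding feasible_def G_def[symmetric]
    proof (intro conjI allI impI ballI)
      fix k assume "k \<notin> V"
      then show "coord (y + \<alpha> *\<^sub>R ?d) k = 0"
        using feasD(1)[OF y] i by (auto simp: lookup_add lookup_single when_def)
    next
      fix k assume "k \<in> V"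
      then show "0 \<le> coord (y + \<alpha> *\<^sub>R ?d) k"
        using feasD(2)[OF y] \<open>\<alpha> \<ge> 0\<close> by (auto simp: lookup_add lookup_single when_def)
    next
      fix W assume W: "W \<subseteq> V"
      show "sum (coord (y + \<alpha> *\<^sub>R ?d)) W \<le> G (card W)"
        unfolding sum_add_scaleR_coord d[OF W]
        using feasD(3)[OF y W] le[of W] W \<open>\<alpha> \<ge> 0\<close> by auto
    qed
    have tight: "sum (coord (y + \<alpha> *\<^sub>R ?d)) S = G (card S)"
      using S unfolding sum_add_scaleR_coord by (simp add: d)
    have "y + \<alpha> *\<^sub>R ?d \<in> H"
    proof (cases "S = V")
      case True
      with full_case[OF up] tight False show ?thesis by simp
    next
      case False
      then have "S \<subset> V" "S \<noteq> {}" using S by auto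
      from tight_case[OF up this tight] show ?thesis .
    qed
    moreover have "y - coord y i *\<^sub>R ?d \<in> H"
    proof (rule zero_case[OF _ i])
      have c: "coord (y - coord y i *\<^sub>R ?d) k = (if k = i then 0 else coord y k)" for k
        by (simp add: lookup_minus lookup_single when_def)
      show "coord (y - coord y i *\<^sub>R ?d) i = 0" by (simp add: c)
      have "sum (coord (y - coord y i *\<^sub>R ?d)) W \<le> G (card W)" if W: "W \<subseteq> V" for W
      proof -
        have "sum (coord (y - coord y i *\<^sub>R ?d)) W \<le> sum (coord y) W"
          by (rule sum_mono) (use c feasD(2)[OF y] W in auto)
        then show ?thesis using feasD(3)[OF y W] by simp
      qed
      then show "feasible u V (y - coord y i *\<^sub>R ?d)"
        using feasD(1,2)[OF y] i by (auto simp: feasible_def G_def[symmetric] c)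
    qed
    ultimately have "y \<in> H"
      using convex_segment[OF convH] \<open>\<alpha> \<ge> 0\<close> feasD(2)[OF y i] by blast
    then show ?thesis by (simp add: H_def)
  qed
qed

section \<open>The parking function polytope\<close>

text \<open>
  In one direction the sorting permutation is the matching. In the other, the matching provides at
  least \<open>i + 1\<close> entries that are at most \<open>F i\<close>, so the entry in position \<open>i\<close> of the sorted list is
  among them.
\<close>

lemma sort_nth_le_iff_matching:
  fixes \<beta> :: "nat list" and F :: "nat \<Rightarrow> nat"
  assumes "mono F" and n: "n = length \<beta>"
  shows "(\<forall>i<n. sort \<beta> ! i \<le> F i) \<longleftrightarrow> (\<exists>\<tau>. bij_betw \<tau> {..<n} {..<n} \<and> (\<forall>j<n. \<beta> ! j \<le> F (\<tau> j)))"
proof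
  assume sorted_le: "\<forall>i<n. sort \<beta> ! i \<le> F i"
  have "mset \<beta> = mset (sort \<beta>)" by simp
  then obtain p where p: "p permutes {..<length (sort \<beta>)}" "permute_list p (sort \<beta>) = \<beta>"
    by (rule mset_eq_permutation)
  have pn: "p permutes {..<n}" using p(1) by (simp add: n)
  have "\<beta> ! j \<le> F (p j)" if "j < n" for j
  proof -
    have "\<beta> ! j = sort \<beta> ! p j"
      using permute_list_nth[OF p(1), of j] that p(2) by (simp add: n)
    moreover have "p j < n" using permutes_in_image[OF pn, of j] that by simp
    ultimately show ?thesis using sorted_le by simp
  qed
  with permutes_imp_bij[OF pn]
  show "\<exists>\<tau>. bij_betw \<tau> {..<n} {..<n} \<and> (\<forall>j<n. \<beta> ! j \<le> F (\<tau> j))" by blast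
next
  assume "\<exists>\<tau>. bij_betw \<tau> {..<n} {..<n} \<and> (\<forall>j<n. \<beta> ! j \<le> F (\<tau> j))"
  then obtain \<tau> where \<tau>: "bij_betw \<tau> {..<n} {..<n}" "\<And>j. j < n \<Longrightarrow> \<beta> ! j \<le> F (\<tau> j)" by blast
  show "\<forall>i<n. sort \<beta> ! i \<le> F i"
  proof (intro allI impI)
    fix i assume i: "i < n"
    have count: "card {j. j < length xs \<and> xs ! j \<le> x} = size (filter_mset (\<lambda>y. y \<le> x) (mset xs))"
      for xs :: "nat list" and x
      unfolding mset_filter[symmetric] size_mset length_filter_conv_card ..
    have "Suc i = card {..i}" by simp
    also have "\<dots> \<le> card {j. j < length \<beta> \<and> \<beta> ! j \<le> F i}"
    proof (rule card_inj_on_le)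
      show "inj_on (inv_into {..<n} \<tau>) {..i}"
        using \<tau>(1) i by (intro inj_on_inv_into) (auto simp: bij_betw_def)
      show "inv_into {..<n} \<tau> ` {..i} \<subseteq> {j. j < length \<beta> \<and> \<beta> ! j \<le> F i}"
      proof (rule image_subsetI)
        fix k assume k: "k \<in> {..i}"
        let ?j = "inv_into {..<n} \<tau> k"
        have "k \<in> \<tau> ` {..<n}" using k i \<tau>(1) by (auto simp: bij_betw_def)
        then have "?j < n" "\<tau> ?j = k" using inv_into_into[of k \<tau> "{..<n}"] by (auto simp: f_inv_into_f)
        moreover have "F k \<le> F i" using k assms(1) by (simp add: monoD)
        ultimately show "?j \<in> {j. j < length \<beta> \<and> \<beta> ! j \<le> F i}"
          using \<tau>(2)[of ?j] n by auto
      qed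
    qed simp
    also have "\<dots> = card {j. j < length (sort \<beta>) \<and> sort \<beta> ! j \<le> F i}"
      unfolding count by simp
    finally have big: "Suc i \<le> card {j. j < length (sort \<beta>) \<and> sort \<beta> ! j \<le> F i}" .
    show "sort \<beta> ! i \<le> F i"
    proof (rule ccontr)
      assume neg: "\<not> sort \<beta> ! i \<le> F i"
      have "{j. j < length (sort \<beta>) \<and> sort \<beta> ! j \<le> F i} \<subseteq> {..<i}"
      proof
        fix j assume j: "j \<in> {j. j < length (sort \<beta>) \<and> sort \<beta> ! j \<le> F i}"
        have "\<not> i \<le> j"
        proof
          assume "i \<le> j"
          then have "sort \<beta> ! i \<le> sort \<beta> ! j" using j by (intro sorted_nth_mono) auto
          with j neg show False by simp
        qed
        then show "j \<in> {..<i}" by simp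
      qed
      then have "card {j. j < length (sort \<beta>) \<and> sort \<beta> ! j \<le> F i} \<le> i"
        using card_mono[of "{..<i}"] by simp
      with big show False by simp
    qed
  qed
qed

lemma sum_ge_choose_two:
  fixes A :: "nat set"
  assumes "finite A"
  shows "card A choose 2 \<le> \<Sum>A"
  using assms
proof (induction A rule: finite_linorder_max_induct)
  case (insert b A)
  have "A \<subseteq> {..<b}" using insert.hyps by auto
  then have "card A \<le> b" using card_mono[of "{..<b}" A] by simp
  moreover have "b \<notin> A" using insert.hyps by auto
  ultimately show ?case
    using insert by (simp add: numeral_2_eq_2)
qed (simp add: numeral_2_eq_2)

lemma sum_lessThan_nat: "\<Sum>{..<n} = (n choose 2)"
  by (induction n) (simp_all add: numeral_2_eq_2 lessThan_Suc)

text \<open>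
  The complement of \<open>A\<close> has sum at least \<open>binom(n - |A|, 2)\<close>, since distinct natural numbers are at
  least \<open>0, 1, 2, \<dots>\<close> in order.
\<close>

lemma sum_le_edges_meeting:
  assumes "A \<subseteq> {..<n}"
  shows "(\<Sum>i\<in>A. int i) \<le> edges_meeting n (card A)"
proof -
  have fin: "finite A" using assms finite_subset by blast
  define r where "r = \<Sum>A"
  have "\<Sum>({..<n} - A) + r = n choose 2"
    using sum.subset_diff[OF assms, of "\<lambda>x. x"] sum_lessThan_nat[of n] by (simp add: r_def)
  moreover have "card ({..<n} - A) = n - card A" using assms fin by (simp add: card_Diff_subset)
  then have "(n - card A) choose 2 \<le> \<Sum>({..<n} - A)" using sum_ge_choose_two[of "{..<n} - A"] by simp
  ultimately have "((n - card A) choose 2) + r \<le> n choose 2" by simp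
  then have "int r \<le> edges_meeting n (card A)" unfolding edges_meeting_def by linarith
  then show ?thesis by (simp add: r_def)
qed

lemma sum_largest_eq_edges_meeting:
  assumes "s \<le> n"
  shows "(\<Sum>l<s. int (n - 1 - l)) = edges_meeting n s"
  using assms
proof (induction s)
  case (Suc s)
  have "2 * edges_meeting n (Suc s) = 2 * (edges_meeting n s + int (n - 1 - s))"
    using Suc.prems twice_edges_meeting[of s n] twice_edges_meeting[of "Suc s" n]
    by (simp add: of_nat_diff algebra_simps)
  with Suc show ?case by simp
qed simp

text \<open>
  The entries of the largest parking function, diminished by \<open>1\<close> and in nonincreasing order. From
  \<open>l = n\<close> on, truncated subtraction makes the sequence constant, so it is nonincreasing and
  nonnegative throughout.
\<close>

definition increments :: "nat \<Rightarrow> nat \<Rightarrow> nat \<Rightarrow> nat \<Rightarrow> nat" where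
  "increments a b n l = a - 1 + (n - 1 - l) * b"

definition rank_bound :: "nat \<Rightarrow> nat \<Rightarrow> nat \<Rightarrow> nat \<Rightarrow> int" where
  "rank_bound a b n s = (int a - 1) * int s + int b * edges_meeting n s"

lemma sum_increments:
  assumes "a > 0" "s \<le> n"
  shows "(\<Sum>l<s. real (increments a b n l)) = of_int (rank_bound a b n s)"
proof -
  have "int (increments a b n l) = (int a - 1) + int b * int (n - 1 - l)" for l
    unfolding increments_def using assms(1) by (simp add: of_nat_diff mult.commute)
  then have "(\<Sum>l<s. int (increments a b n l)) = int s * (int a - 1) + int b * (\<Sum>l<s. int (n - 1 - l))"
    by (simp only: sum.distrib sum_distrib_left sum_constant card_lessThan)
  also have "\<dots> = rank_bound a b n s"
    unfolding sum_largest_eq_edges_meeting[OF assms(2)] rank_bound_def by (simp add: mult.commute)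
  finally have "real_of_int (\<Sum>l<s. int (increments a b n l)) = of_int (rank_bound a b n s)" by simp
  then show ?thesis by simp
qed

lemma sum_list_take_param_vector:
  assumes "i < n"
  shows "sum_list (take (Suc i) (param_vector n a b)) = a + i * b"
  using assms by (cases n) (simp_all add: sum_list_replicate)

lemma length_param_vector [simp]: "length (param_vector n a b) = n"
  by (cases n) simp_all

lemma parking_functions_iff_matching:
  "\<beta> \<in> parking_functions (param_vector n a b) \<longleftrightarrow> length \<beta> = n \<and> (\<forall>x\<in>set \<beta>. x > 0) \<and>
    (\<exists>\<tau>. bij_betw \<tau> {..<n} {..<n} \<and> (\<forall>j<n. \<beta> ! j \<le> a + \<tau> j * b))"
proof -
  have "mono (\<lambda>i. a + i * b)" by (intro monoI) simp
  from sort_nth_le_iff_matching[OF this, of n \<beta>] show ?thesis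
    unfolding parking_functions_def by (auto simp: sum_list_take_param_vector)
qed

text \<open>
  The description by inequalities: after subtracting \<open>1\<close> from every coordinate, the points of the
  symmetric polymatroid with rank function \<open>rank_bound\<close>.
\<close>

definition in_parking_polytope :: "nat \<Rightarrow> nat \<Rightarrow> nat \<Rightarrow> (nat \<Rightarrow>\<^sub>0 real) \<Rightarrow> bool" where
  "in_parking_polytope n a b x \<longleftrightarrow> (\<forall>i. i \<notin> {..<n} \<longrightarrow> coord x i = 0) \<and> (\<forall>i<n. 1 \<le> coord x i) \<and>
     (\<forall>S\<subseteq>{..<n}. (\<Sum>i\<in>S. coord x i - 1) \<le> of_int (rank_bound a b n (card S)))"

lemma coord_nth: "coord (Poly_Mapping.nth (map real \<beta>)) i = (if i < length \<beta> then real (\<beta> ! i) else 0)"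
  by (simp add: nth_default_def)

lemma parking_function_in_parking_polytope:
  assumes "\<beta> \<in> parking_functions (param_vector n a b)"
  shows "in_parking_polytope n a b (Poly_Mapping.nth (map real \<beta>))"
proof -
  obtain \<tau> where len: "length \<beta> = n" and pos: "\<And>j. j < n \<Longrightarrow> 0 < \<beta> ! j"
    and \<tau>: "bij_betw \<tau> {..<n} {..<n}" "\<And>j. j < n \<Longrightarrow> \<beta> ! j \<le> a + \<tau> j * b"
    using assms unfolding parking_functions_iff_matching by auto
  have "(\<Sum>j\<in>S. real (\<beta> ! j) - 1) \<le> of_int (rank_bound a b n (card S))" if S: "S \<subseteq> {..<n}" for S
  proof -
    have inj: "inj_on \<tau> S" using \<tau>(1) S by (auto simp: bij_betw_def intro: inj_on_subset)
    have "\<tau> ` S \<subseteq> {..<n}" using \<tau>(1) S by (auto simp: bij_betw_def)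
    from sum_le_edges_meeting[OF this] have e: "(\<Sum>j\<in>S. int (\<tau> j)) \<le> edges_meeting n (card S)"
      using card_image[OF inj] by (simp add: sum.reindex[OF inj])
    have "(\<Sum>j\<in>S. int (\<beta> ! j) - 1) \<le> (\<Sum>j\<in>S. (int a - 1) + int b * int (\<tau> j))"
    proof (rule sum_mono)
      fix j assume "j \<in> S"
      then have "\<beta> ! j \<le> a + \<tau> j * b" using \<tau>(2)[of j] S by auto
      then have "int (\<beta> ! j) \<le> int (a + \<tau> j * b)" by (simp only: of_nat_le_iff)
      then show "int (\<beta> ! j) - 1 \<le> (int a - 1) + int b * int (\<tau> j)" by (simp add: mult.commute)
    qed
    also have "\<dots> = (int a - 1) * int (card S) + int b * (\<Sum>j\<in>S. int (\<tau> j))"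
      by (simp add: sum.distrib sum_distrib_left)
    also have "\<dots> \<le> rank_bound a b n (card S)"
      unfolding rank_bound_def using e by (intro add_left_mono mult_left_mono) auto
    finally have le: "(\<Sum>j\<in>S. int (\<beta> ! j) - 1) \<le> rank_bound a b n (card S)" .
    have "(\<Sum>j\<in>S. real (\<beta> ! j) - 1) = of_int (\<Sum>j\<in>S. int (\<beta> ! j) - 1)" by simp
    then show ?thesis using le by (simp only: of_int_le_iff)
  qed
  moreover have "(\<Sum>j\<in>S. coord (Poly_Mapping.nth (map real \<beta>)) j - 1) = (\<Sum>j\<in>S. real (\<beta> ! j) - 1)" if "S \<subseteq> {..<n}" for S
    using that len by (intro sum.cong) (auto simp: coord_nth simp del: lookup_nth)
  moreover have "1 \<le> real (\<beta> ! j)" if "j < n" for j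
    using pos[OF that] by simp
  ultimately show ?thesis
    unfolding in_parking_polytope_def using len by (auto simp: coord_nth simp del: lookup_nth)
qed

lemma convex_in_parking_polytope: "convex {x. in_parking_polytope n a b x}"
proof (rule convexI)
  fix x y :: "nat \<Rightarrow>\<^sub>0 real" and u v :: real
  assume x: "x \<in> {x. in_parking_polytope n a b x}" and y: "y \<in> {x. in_parking_polytope n a b x}"
    and uv: "0 \<le> u" "0 \<le> v" "u + v = 1"
  have c: "coord (u *\<^sub>R x + v *\<^sub>R y) i = u * coord x i + v * coord y i" for i by (simp add: lookup_add)
  have "1 \<le> coord (u *\<^sub>R x + v *\<^sub>R y) i" if "i < n" for i
  proof -
    have "u * 1 + v * 1 \<le> u * coord x i + v * coord y i"
      using x y uv that unfolding in_parking_polytope_def by (intro add_mono mult_left_mono) auto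
    then show ?thesis using uv by (simp add: c)
  qed
  moreover have "(\<Sum>i\<in>S. coord (u *\<^sub>R x + v *\<^sub>R y) i - 1) \<le> of_int (rank_bound a b n (card S))" if S: "S \<subseteq> {..<n}" for S
  proof -
    have "coord (u *\<^sub>R x + v *\<^sub>R y) i - 1 = u * (coord x i - 1) + v * (coord y i - 1)" for i
      using uv(3) unfolding c by (simp add: algebra_simps)
    then have "(\<Sum>i\<in>S. coord (u *\<^sub>R x + v *\<^sub>R y) i - 1) = u * (\<Sum>i\<in>S. coord x i - 1) + v * (\<Sum>i\<in>S. coord y i - 1)"
      by (simp add: sum.distrib sum_distrib_left)
    also have "\<dots> \<le> u * of_int (rank_bound a b n (card S)) + v * of_int (rank_bound a b n (card S))"
      using x y uv S unfolding in_parking_polytope_def by (intro add_mono mult_left_mono) auto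
    also have "\<dots> = of_int (rank_bound a b n (card S))" using uv(3) by (simp flip: distrib_right)
    finally show ?thesis .
  qed
  moreover have "coord (u *\<^sub>R x + v *\<^sub>R y) i = 0" if "i \<notin> {..<n}" for i
    using x y that unfolding c in_parking_polytope_def by simp
  ultimately show "u *\<^sub>R x + v *\<^sub>R y \<in> {x. in_parking_polytope n a b x}"
    unfolding in_parking_polytope_def by blast
qed

text \<open>
  The order of the increments is reversed, since \<open>u 0\<close> belongs to the largest bound \<open>a + (n - 1) b\<close>.
\<close>

lemma shifted_vertex_is_parking_function:
  assumes "a > 0" "v \<in> greedy_vertices (\<lambda>l. real (increments a b n l)) {..<n}"
  shows "vec_on (\<lambda>_. 1) {..<n} + v \<in> (\<lambda>\<beta>. Poly_Mapping.nth (map real \<beta>)) ` parking_functions (param_vector n a b)"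
proof -
  obtain \<sigma> where v: "\<And>i. i \<notin> {..<n} \<Longrightarrow> coord v i = 0" and \<sigma>: "bij_betw \<sigma> {..<n} {..<n}"
    "\<And>i. i < n \<Longrightarrow> coord v i = 0 \<or> coord v i = real (increments a b n (\<sigma> i))"
    using assms(2) by (auto simp: greedy_vertices_def)
  define \<beta> where "\<beta> = map (\<lambda>i. if coord v i = 0 then 1 else 1 + increments a b n (\<sigma> i)) [0..<n]"
  have "vec_on (\<lambda>_. 1) {..<n} + v = Poly_Mapping.nth (map real \<beta>)"
  proof (rule poly_mapping_eqI)
    fix i
    show "coord (vec_on (\<lambda>_. 1) {..<n} + v) i = coord (Poly_Mapping.nth (map real \<beta>)) i"
      unfolding coord_nth lookup_add using v[of i] \<sigma>(2)[of i] by (auto simp: coord_vec_on \<beta>_def)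
  qed
  moreover have "\<beta> \<in> parking_functions (param_vector n a b)"
    unfolding parking_functions_iff_matching
  proof (intro conjI exI[of _ "\<lambda>j. n - 1 - \<sigma> j"])
    have "bij_betw (\<lambda>k. n - 1 - k) {..<n} {..<n}"
      by (rule bij_betw_byWitness[where f' = "\<lambda>k. n - 1 - k"]) auto
    from bij_betw_trans[OF \<sigma>(1) this] show "bij_betw (\<lambda>j. n - 1 - \<sigma> j) {..<n} {..<n}"
      by (simp add: comp_def)
    show "\<forall>j<n. \<beta> ! j \<le> a + (n - 1 - \<sigma> j) * b"
      using assms(1) by (auto simp: \<beta>_def increments_def)
  qed (auto simp: \<beta>_def)
  ultimately show ?thesis by blast
qed

lemma parking_polytope_eq:
  assumes "a > 0"
  shows "parking_polytope (param_vector n a b) = {x. in_parking_polytope n a b x}"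
proof
  show "parking_polytope (param_vector n a b) \<subseteq> {x. in_parking_polytope n a b x}"
    unfolding parking_polytope_def
    by (rule hull_minimal) (use parking_function_in_parking_polytope convex_in_parking_polytope in auto)
  show "{x. in_parking_polytope n a b x} \<subseteq> parking_polytope (param_vector n a b)"
  proof
    fix x assume "x \<in> {x. in_parking_polytope n a b x}"
    then have x: "in_parking_polytope n a b x" by simp
    let ?one = "vec_on (\<lambda>_. 1) {..<n}" and ?u = "\<lambda>l. real (increments a b n l)"
    have "feasible ?u {..<n} (x - ?one)"
      unfolding feasible_def
    proof (intro conjI allI impI ballI)
      fix S :: "nat set" assume S: "S \<subseteq> {..<n}"
      then have "card S \<le> n" using card_mono[of "{..<n}" S] by simp
      have "sum (coord (x - ?one)) S = (\<Sum>i\<in>S. coord x i - 1)"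
        using S by (intro sum.cong) (auto simp: lookup_minus coord_vec_on)
      then show "sum (coord (x - ?one)) S \<le> (\<Sum>l<card S. ?u l)"
        using x S sum_increments[OF assms \<open>card S \<le> n\<close>, of b] by (simp add: in_parking_polytope_def)
    qed (use x in \<open>auto simp: in_parking_polytope_def lookup_minus coord_vec_on\<close>)
    then have "x - ?one \<in> convex hull (greedy_vertices ?u {..<n})"
      by (rule feasible_in_hull[rotated]) (auto simp: increments_def intro!: mult_right_mono)
    then have "?one + (x - ?one) \<in> (+) ?one ` (convex hull (greedy_vertices ?u {..<n}))" by blast
    then have "x \<in> convex hull ((+) ?one ` greedy_vertices ?u {..<n})"
      by (simp add: convex_hull_translation)
    moreover have "(+) ?one ` greedy_vertices ?u {..<n} \<subseteq> (\<lambda>\<beta>. Poly_Mapping.nth (map real \<beta>)) ` parking_functions (param_vector n a b)"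
      using shifted_vertex_is_parking_function[OF assms] by auto
    ultimately show "x \<in> parking_polytope (param_vector n a b)"
      unfolding parking_polytope_def using hull_mono by blast
  qed
qed

text \<open>
  Subtracting \<open>k\<close> from every coordinate maps the lattice points of the \<open>k\<close>-th dilate onto the integer points
  of the polymatroid.
\<close>

lemma card_lattice_points:
  assumes "a > 0" "k > 0"
  shows "card ((\<lambda>x. real k *\<^sub>R x) ` parking_polytope (param_vector n a b) \<inter> integer_lattice n) =
    polymatroid_count (int k * int b) (int k * (int a - 1) + 1) n"
proof -
  let ?L = "(\<lambda>x. real k *\<^sub>R x) ` parking_polytope (param_vector n a b) \<inter> integer_lattice n"
  let ?B = "bounded_points (\<lambda>_. 0) (\<lambda>s. (int k * (int a - 1) + 1 - 1) * int s + int k * int b * edges_meeting n s) {..<n}"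
  let ?f = "\<lambda>z. \<lambda>i\<in>{..<n}. \<lfloor>coord z i\<rfloor> - int k"
  let ?g = "\<lambda>y. vec_on (\<lambda>i. of_int (y i) + real k) {..<n}"
  have bound: "(int k * (int a - 1) + 1 - 1) * int s + int k * int b * edges_meeting n s = int k * rank_bound a b n s" for s
    by (simp add: rank_bound_def algebra_simps)
  have mem: "z \<in> ?L \<longleftrightarrow> (\<forall>i. i \<notin> {..<n} \<longrightarrow> coord z i = 0) \<and> (\<forall>i<n. coord z i \<in> \<int> \<and> real k \<le> coord z i) \<and>
     (\<forall>S\<subseteq>{..<n}. (\<Sum>i\<in>S. coord z i - real k) \<le> real k * of_int (rank_bound a b n (card S)))" (is "_ \<longleftrightarrow> ?R z") for z
  proof -
    let ?x = "(1 / real k) *\<^sub>R z"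
    have "z \<in> (\<lambda>x. real k *\<^sub>R x) ` parking_polytope (param_vector n a b) \<longleftrightarrow> in_parking_polytope n a b ?x"
    proof
      assume "z \<in> (\<lambda>x. real k *\<^sub>R x) ` parking_polytope (param_vector n a b)"
      then show "in_parking_polytope n a b ?x" using assms by (auto simp: parking_polytope_eq)
    next
      assume "in_parking_polytope n a b ?x"
      moreover have "z = real k *\<^sub>R ?x" using assms by simp
      ultimately show "z \<in> (\<lambda>x. real k *\<^sub>R x) ` parking_polytope (param_vector n a b)"
        unfolding parking_polytope_eq[OF assms(1)] by blast
    qed
    also have "\<dots> \<longleftrightarrow> (\<forall>i. i \<notin> {..<n} \<longrightarrow> coord z i = 0) \<and> (\<forall>i<n. real k \<le> coord z i) \<and>
     (\<forall>S\<subseteq>{..<n}. (\<Sum>i\<in>S. coord z i - real k) \<le> real k * of_int (rank_bound a b n (card S)))"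
    proof -
      have "(\<Sum>i\<in>S. coord ?x i - 1) = (\<Sum>i\<in>S. coord z i - real k) / real k" for S
        using assms(2) by (simp add: sum_divide_distrib diff_divide_distrib)
      then show ?thesis using assms(2)
        by (simp add: in_parking_polytope_def pos_divide_le_eq pos_le_divide_eq mult.commute)
    qed
    moreover have "Poly_Mapping.keys z \<subseteq> {..<n} \<longleftrightarrow> (\<forall>i. i \<notin> {..<n} \<longrightarrow> coord z i = 0)"
      by (auto simp: in_keys_iff)
    ultimately show ?thesis unfolding integer_lattice_def by auto
  qed
  have sum_shift: "(\<Sum>i\<in>S. coord (?g y) i - real k) = of_int (sum y S)" if "S \<subseteq> {..<n}" for S y
  proof -
    have "(\<Sum>i\<in>S. coord (?g y) i - real k) = (\<Sum>i\<in>S. of_int (y i))"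
      using that by (intro sum.cong) (auto simp: coord_vec_on)
    then show ?thesis by simp
  qed
  have gf: "?g (?f z) = z" if "z \<in> ?L" for z
  proof (rule poly_mapping_eqI)
    fix i show "coord (?g (?f z)) i = coord z i"
      using that unfolding mem by (cases "i < n") (auto simp: coord_vec_on elim!: Ints_cases)
  qed
  have fg: "?f (?g y) = y" if "y \<in> ?B" for y
    using that by (auto simp: bounded_points_def fun_eq_iff coord_vec_on PiE_iff extensional_def)
  have g_mem: "?g y \<in> ?L \<longleftrightarrow> (\<forall>i<n. 0 \<le> y i) \<and> (\<forall>S\<subseteq>{..<n}. sum y S \<le> int k * rank_bound a b n (card S))" for y
  proof -
    have "real_of_int (sum y S) \<le> real k * of_int (rank_bound a b n (card S)) \<longleftrightarrow> sum y S \<le> int k * rank_bound a b n (card S)" for S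
      by (metis of_int_le_iff of_int_mult of_int_of_nat_eq)
    then show ?thesis unfolding mem using sum_shift[of _ y] by (simp add: coord_vec_on)
  qed
  have "bij_betw ?f ?L ?B"
  proof (rule bij_betw_byWitness[where f' = ?g])
    show "\<forall>z\<in>?L. ?g (?f z) = z" using gf by blast
    show "\<forall>y\<in>?B. ?f (?g y) = y" using fg by blast
    show "?f ` ?L \<subseteq> ?B"
    proof (rule image_subsetI)
      fix z assume z: "z \<in> ?L"
      then have "?g (?f z) \<in> ?L" using gf by simp
      then have nn: "\<forall>i<n. 0 \<le> ?f z i" and le: "\<And>S. S \<subseteq> {..<n} \<Longrightarrow> sum (?f z) S \<le> int k * rank_bound a b n (card S)"
        unfolding g_mem by blast+
      have "0 \<le> sum (?f z) S" if "S \<subseteq> {..<n}" for S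
        by (rule sum_nonneg) (use nn that in blast)
      with le show "?f z \<in> ?B" unfolding bounded_points_def bound by auto
    qed
    show "?g ` ?B \<subseteq> ?L"
    proof (rule image_subsetI)
      fix y assume y: "y \<in> ?B"
      have "0 \<le> y i" if "i < n" for i using bounded_points_coordinate(1)[OF y, of i] that by simp
      moreover have "sum y S \<le> int k * rank_bound a b n (card S)" if "S \<subseteq> {..<n}" for S
        using bounded_points_sum(2)[OF y that] bound by (cases "S = {}") (auto simp: rank_bound_def)
      ultimately show "?g y \<in> ?L" unfolding g_mem by blast
    qed
  qed
  then have "card ?L = card ?B" by (rule bij_betw_same_card)
  then show ?thesis by (simp add: polymatroid_count_def bounded_point_count_def)
qed

section \<open>The Ehrhart polynomial\<close>

definition explicit_poly :: "nat \<Rightarrow> nat \<Rightarrow> nat \<Rightarrow> real poly" where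
  "explicit_poly n a b = smult (1 / 2 ^ n)
     (\<Sum>i=0..n div 2. \<Sum>j=2*i..n.
        smult ((-1) ^ (i + 1) * (fact n / (fact (n - j) * fact (j - 2 * i) * fact i * fact i)) * fact i
                 * dfact_2m_minus_3 (j - 2 * i))
          ([:0, real b:] ^ (j - i) * [:2, 2 * real b * real n - real b + 2 * real a - 2:] ^ (n - j)))"

lemma poly_explicit_poly:
  "poly (explicit_poly n a b) t =
     explicit_count n (real b * t) ((2 * real b * real n - real b + 2 * real a - 2) * t + 2)"
  by (simp add: explicit_poly_def explicit_count_def poly_sum mult.assoc mult.commute[of t] add.commute[of 2])

text \<open>
  Two polynomials that agree at all positive integers are equal.
\<close>

lemma ehrhart_poly_parking:
  assumes "a > 0" "b > 0"
  shows "ehrhart_poly n (parking_polytope (param_vector n a b)) = explicit_poly n a b"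
  unfolding ehrhart_poly_def
proof (rule the_equality)
  let ?card = "\<lambda>k. card ((\<lambda>x. real k *\<^sub>R x) ` parking_polytope (param_vector n a b) \<inter> integer_lattice n)"
  show count: "\<forall>k>0. poly (explicit_poly n a b) (real k) = real (?card k)"
  proof (intro allI impI)
    fix k :: nat assume k: "k > 0"
    have "real (?card k) = explicit_count n (of_int (int k * int b))
       (2 * of_int (int k * (int a - 1) + 1) - of_int (int k * int b) + 2 * of_int (int k * int b) * real n)"
      unfolding card_lattice_points[OF assms(1) k]
      by (rule polymatroid_count_explicit) (use assms k in \<open>auto simp: Suc_le_eq int_one_le_iff_zero_less\<close>)
    also have "2 * of_int (int k * (int a - 1) + 1) - of_int (int k * int b) + 2 * of_int (int k * int b) * real n =
        (2 * real b * real n - real b + 2 * real a - 2) * real k + 2"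
      by (simp add: algebra_simps)
    finally show "poly (explicit_poly n a b) (real k) = real (?card k)"
      by (simp add: poly_explicit_poly mult.commute)
  qed
  fix p :: "real poly" assume p: "\<forall>k>0. poly p (real k) = real (?card k)"
  have "poly (p - explicit_poly n a b) x = 0" if "x \<in> real ` {0<..}" for x
    using that p count by auto
  then have "real ` {0<..} \<subseteq> {x. poly (p - explicit_poly n a b) x = 0}" by blast
  moreover have "infinite (real ` {0<..})"
    using infinite_Ioi[of "0::nat"] by (simp add: finite_image_iff)
  ultimately have "infinite {x. poly (p - explicit_poly n a b) x = 0}" using finite_subset by blast
  then have "p - explicit_poly n a b = 0" using poly_roots_finite by blast
  then show "p = explicit_poly n a b" by simp
qed

lemma poly_ehr_parking:
  assumes "a > 0" "b > 0"
  shows "poly (ehr_parking n a b) t =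
     explicit_count n (real b * t) ((2 * real b * real n - real b + 2 * real a - 2) * t + 2)"
proof (cases "n = 0")
  case True
  then show ?thesis by (simp add: ehr_parking_def explicit_count_def dfact_2m_minus_3_def)
qed (simp add: ehr_parking_def ehrhart_poly_parking[OF assms] poly_explicit_poly)

lemma ehr_parking_gf:
  assumes "a > 0" "b > 0" "t \<noteq> 0"
  shows "Abs_fps (\<lambda>n. poly (ehr_parking n a b) t / fact n) =
    ehrhart_gf (real b * t) ((real a - 1) / real b - 1 / 2 + 1 / (real b * t))"
proof -
  let ?\<beta> = "(real a - 1) / real b - 1 / 2 + 1 / (real b * t)"
  have "2 * (real b * t) * (?\<beta> + real n) = (2 * real b * real n - real b + 2 * real a - 2) * t + 2" for n
    using assms by (simp add: field_simps)
  then show ?thesis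
    using assms by (simp add: ehrhart_gf_eq_egf egf_def poly_ehr_parking)
qed

text \<open>
  Composition with \<open>T\<close> commutes with the square root, the inverse and the exponential.
\<close>

lemma ehrhart_gf_composed:
  "ehrhart_gf m \<beta> = inverse (fps_radical root 2 (1 - scaled_tree_fps m))
     * (fps_exp 1 oo (fps_const \<beta> * scaled_tree_fps m - fps_const (1 / (4 * m)) * scaled_tree_fps m ^ 2))"
proof -
  let ?T = "scaled_tree_fps m" and ?R = "fps_radical root 2 (1 - fps_X) :: real fps"
  have "?R oo ?T = fps_radical root 2 ((1 - fps_X) oo ?T)"
    using fps_compose_radical[of ?T root 1 "1 - fps_X"] by (simp add: numeral_2_eq_2)
  then have R: "inverse ?R oo ?T = inverse (fps_radical root 2 (1 - ?T))"
    by (simp add: fps_inverse_compose fps_compose_sub_distrib)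
  have "(fps_const \<beta> * fps_X + fps_const (- 1 / (4 * m)) * fps_X ^ 2) oo ?T =
      fps_const \<beta> * ?T - fps_const (1 / (4 * m)) * ?T ^ 2"
    by (simp add: fps_compose_add_distrib fps_compose_mult_distrib fps_compose_power[symmetric] fps_compose_uminus fps_compose_sub_distrib fps_const_neg[symmetric] del: fps_const_neg)
  then have "quadratic_exp \<beta> (- 1 / (4 * m)) oo ?T =
      fps_exp 1 oo (fps_const \<beta> * ?T - fps_const (1 / (4 * m)) * ?T ^ 2)"
    unfolding quadratic_exp_def by (simp add: fps_compose_assoc[symmetric])
  with R show ?thesis
    unfolding ehrhart_gf_def fps_compose_mult_distrib[OF scaled_tree_fps_nth_0] by simp
qed

theorem theorem6p4:
  shows "(\<forall>(a::nat) (b::nat) (n::nat) (t::real). a > 0 \<and> b > 0 \<and> n > 0 \<longrightarrow>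
      poly (ehr_parking n a b) t =
        1 / 2 ^ n *
        (\<Sum>i=0..n div 2. \<Sum>j=2*i..n.
           (-1) ^ (i + 1)
           * (fact n / (fact (n - j) * fact (j - 2 * i) * fact i * fact i))
           * fact i
           * dfact_2m_minus_3 (j - 2 * i)
           * (real b * t) ^ (j - i)
           * ((2 * real b * real n - real b + 2 * real a - 2) * t + 2) ^ (n - j)))
    \<and>
    (\<forall>(a::nat) (b::nat) (t::real). a > 0 \<and> b > 0 \<and> t \<noteq> 0 \<longrightarrow>
      (let \<beta> = (real a - 1) / real b - 1 / 2 + 1 / (real b * t);
           T = tree_fps oo (fps_const (real b * t) * fps_X)
       in Abs_fps (\<lambda>n. poly (ehr_parking n a b) t / fact n) =
            inverse (fps_radical root 2 (1 - T))
            * (fps_exp 1 oo (fps_const \<beta> * T - fps_const (1 / (4 * real b * t)) * T ^ 2))))"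
proof (intro conjI allI impI)
  fix a b n :: nat and t :: real
  assume "a > 0 \<and> b > 0 \<and> n > 0"
  then show "poly (ehr_parking n a b) t =
        1 / 2 ^ n *
        (\<Sum>i=0..n div 2. \<Sum>j=2*i..n.
           (-1) ^ (i + 1)
           * (fact n / (fact (n - j) * fact (j - 2 * i) * fact i * fact i))
           * fact i
           * dfact_2m_minus_3 (j - 2 * i)
           * (real b * t) ^ (j - i)
           * ((2 * real b * real n - real b + 2 * real a - 2) * t + 2) ^ (n - j))"
    unfolding explicit_count_def[symmetric] by (intro poly_ehr_parking) auto
next
  fix a b :: nat and t :: real
  assume "a > 0 \<and> b > 0 \<and> t \<noteq> 0"
  then show "let \<beta> = (real a - 1) / real b - 1 / 2 + 1 / (real b * t);
           T = tree_fps oo (fps_const (real b * t) * fps_X)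
       in Abs_fps (\<lambda>n. poly (ehr_parking n a b) t / fact n) =
            inverse (fps_radical root 2 (1 - T))
            * (fps_exp 1 oo (fps_const \<beta> * T - fps_const (1 / (4 * real b * t)) * T ^ 2))"
    unfolding Let_def scaled_tree_fps_def[symmetric]
    by (simp add: ehr_parking_gf ehrhart_gf_composed mult.assoc)
qed

end
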